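(* Let $p=p_1\ldots p_m$ be a string of pairwise distinct integers from $[n]$ and $t=t_1\ldots t_n$ a permutation of $[n]$. All occurrences of $p$ as a consecutive motif in $t$ can be found in $O(m\log\log m+n)$ time.
   Context: Strings $u_1\ldots u_k$, $v_1\ldots v_k$ with pairwise distinct entries are order-isomorphic if for all $a<b$, $u_a>u_b \iff v_a>v_b$. The pattern $p$ occurs (as a consecutive motif) in $t$ at position $i$ if $p_1\ldots p_m$ is order-isomorphic to $t_i\ldots t_{i+m-1}$. The computational model is the word RAM. *)

theory Defs
  imports Complex_Main "HOL-Combinatorics.Multiset_Permutations"
begin

definition order_isomorphic :: "nat list \<Rightarrow> nat list \<Rightarrow> bool" where
  "order_isomorphic u v \<longleftrightarrow>
     length u = length v \<and>
     (\<forall>a b. a < b \<and> b < length u \<longrightarrow> (u ! a > u ! b \<longleftrightarrow> v ! a > v ! b))"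

text \<open>Positions are counted from 1, whereas list indices start at 0.\<close>

definition occurs_at :: "nat list \<Rightarrow> nat list \<Rightarrow> nat \<Rightarrow> bool" where
  "occurs_at p t i \<longleftrightarrow>
     1 \<le> i \<and> i + length p \<le> length t + 1 \<and>
     order_isomorphic p (take (length p) (drop (i - 1) t))"


text \<open>
  The word size \<open>w\<close> is a run-time parameter, not a type, because one program has to work
  for all word sizes.  Words are natural numbers below \<open>2 ^ w\<close>, and every computed word is
  reduced by \<^const>\<open>take_bit\<close>.  Addresses are words, so at most \<open>2 ^ w\<close> memory cells can be
  reached.  A program mentions only finitely many registers.  The run ends when the program
  counter leaves the program.
\<close>

datatype binop = Add | Sub | Mul | Div | Mod | And | Or | Xor | Shl | Shr

datatype instr =
    Const nat nat
  | BinOp binop nat nat nat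
  | Load nat nat
  | Store nat nat
  | Jump_Less nat nat nat
  | Jump_Eq nat nat nat

type_synonym program = "instr list"

record config =
  pc :: nat
  regs :: "nat \<Rightarrow> nat"
  mem :: "nat \<Rightarrow> nat"

text \<open>Adding \<open>2 ^ w\<close> in the clause for subtraction makes it wrap around instead of
  truncating at 0.  Division by 0 follows the HOL conventions.\<close>

fun binop_val :: "nat \<Rightarrow> binop \<Rightarrow> nat \<Rightarrow> nat \<Rightarrow> nat" where
  "binop_val w Add x y = x + y"
| "binop_val w Sub x y = (x + 2 ^ w) - y"
| "binop_val w Mul x y = x * y"
| "binop_val w Div x y = x div y"
| "binop_val w Mod x y = x mod y"
| "binop_val w And x y = Bit_Operations.and x y"
| "binop_val w Or x y = Bit_Operations.or x y"
| "binop_val w Xor x y = Bit_Operations.xor x y"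
| "binop_val w Shl x y = push_bit y x"
| "binop_val w Shr x y = drop_bit y x"

definition set_reg :: "nat \<Rightarrow> nat \<Rightarrow> config \<Rightarrow> config" where
  "set_reg r x c = c\<lparr>pc := Suc (pc c), regs := (regs c)(r := x)\<rparr>"

fun exec :: "nat \<Rightarrow> instr \<Rightarrow> config \<Rightarrow> config" where
  "exec w (Const r k) c = set_reg r (take_bit w k) c"
| "exec w (BinOp f r r1 r2) c =
     set_reg r (take_bit w (binop_val w f (regs c r1) (regs c r2))) c"
| "exec w (Load r ra) c = set_reg r (mem c (regs c ra)) c"
| "exec w (Store ra r) c = c\<lparr>pc := Suc (pc c), mem := (mem c)(regs c ra := regs c r)\<rparr>"
| "exec w (Jump_Less r1 r2 l) c =
     c\<lparr>pc := (if regs c r1 < regs c r2 then l else Suc (pc c))\<rparr>"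
| "exec w (Jump_Eq r1 r2 l) c =
     c\<lparr>pc := (if regs c r1 = regs c r2 then l else Suc (pc c))\<rparr>"

definition halted :: "program \<Rightarrow> config \<Rightarrow> bool" where
  "halted P c \<longleftrightarrow> length P \<le> pc c"

definition step :: "nat \<Rightarrow> program \<Rightarrow> config \<Rightarrow> config" where
  "step w P c = (if halted P c then c else exec w (P ! pc c) c)"

text \<open>The input occupies the memory from address 0 on.  Registers and all other cells
  initially hold arbitrary words.\<close>

definition initial_config :: "nat \<Rightarrow> nat list \<Rightarrow> config \<Rightarrow> bool" where
  "initial_config w xs c \<longleftrightarrow>
     pc c = 0 \<and> (\<forall>r. regs c r < 2 ^ w) \<and> (\<forall>a. mem c a < 2 ^ w) \<and>
     (\<forall>i < length xs. mem c i = xs ! i)"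

text \<open>Cell 0 holds the length of the output, which follows from address 1 on.\<close>

definition output_of :: "config \<Rightarrow> nat list" where
  "output_of c = map (mem c) [1..<Suc (mem c 0)]"

text \<open>Every instruction takes unit time, so time is the number \<open>k\<close> of steps.\<close>

definition runs_within ::
    "nat \<Rightarrow> program \<Rightarrow> nat list \<Rightarrow> real \<Rightarrow> (nat list \<Rightarrow> bool) \<Rightarrow> bool" where
  "runs_within w P xs T Q \<longleftrightarrow>
     (\<forall>c. initial_config w xs c \<longrightarrow>
        (\<exists>k. real k \<le> T \<and> halted P ((step w P ^^ k) c) \<and> Q (output_of ((step w P ^^ k) c))))"

lemma step_words:
  assumes "\<forall>r. regs c r < 2 ^ w" "\<forall>a. mem c a < 2 ^ w"
  shows "(\<forall>r. regs (step w P c) r < 2 ^ w) \<and> (\<forall>a. mem (step w P c) a < 2 ^ w)"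
  using assms by (cases "P ! pc c") (auto simp: step_def set_reg_def)

lemma initial_config_exists:
  assumes "\<forall>x \<in> set xs. x < 2 ^ w"
  shows "\<exists>c. initial_config w xs c"
  using assms
  by (intro exI[of _ "\<lparr>pc = 0, regs = \<lambda>_. 0, mem = \<lambda>a. if a < length xs then xs ! a else 0\<rparr>"])
     (auto simp: initial_config_def)

end

theory Submission
  imports Defs
begin

text \<open>
  Since \<open>m \<le> n\<close>, linear time is enough, and the pattern can be sorted by bucketing.  An order-isomorphism
  between a prefix of the pattern and a window of the text extends by one entry iff the
  new text entry lies between the two text entries matching the order neighbours of the new
  pattern entry among the previous ones.  These neighbours are read off a doubly linked list
  of the sorted pattern from which the entries are deleted from right to left.  With a constant time
  extension test, the algorithm of Knuth, Morris and Pratt carries over: windows of the pattern and of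
  the text are shifted along a failure function for order-isomorphism.
\<close>

section \<open>A while language for the word RAM\<close>

text \<open>The pattern consists of distinct members of \<open>{1..n}\<close>; this gives
  \<open>m \<le> n\<close>, and values can serve as addresses, so no comparison sort is needed. The
  order neighbours are found by deletion because a doubly linked list gives up an element in
  constant time, whereas inserting one would require a search for its place. The time is amortised:
  a successful extension test advances the right end of the window, a shift advances its left end.
  What shapes the proof is the machine: a single program must serve every word size, and it starts
  from memory with arbitrary contents outside the input. Overflow is excluded by side conditions on
  expressions, which \<open>40 * n \<le> 2 ^ w\<close> discharges; all later reasoning is about
  natural numbers and table invariants.\<close>

datatype expr = Var nat | Num nat | Plus expr expr | Minus expr expr | Times expr expr | At expr

datatype com =
    Skip
  | Assign nat expr  (infix "::=" 63)
  | Write expr expr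
  | Seq com com  (infixr ";;" 60)
  | If_Less expr expr com com
  | While_Less expr expr com

type_synonym state = "(nat \<Rightarrow> nat) \<times> (nat \<Rightarrow> nat)"

text \<open>The variable \<open>x\<close> lives in register \<open>2 * x\<close>; the odd registers form the stack on which
  expressions are evaluated.\<close>

fun comp_expr :: "expr \<Rightarrow> nat \<Rightarrow> program" where
  "comp_expr (Var x) d = [BinOp And (2 * d + 1) (2 * x) (2 * x)]"
| "comp_expr (Num k) d = [Const (2 * d + 1) k]"
| "comp_expr (Plus a b) d =
     comp_expr a d @ comp_expr b (Suc d) @ [BinOp Add (2 * d + 1) (2 * d + 1) (2 * d + 3)]"
| "comp_expr (Minus a b) d =
     comp_expr a d @ comp_expr b (Suc d) @ [BinOp Sub (2 * d + 1) (2 * d + 1) (2 * d + 3)]"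
| "comp_expr (Times a b) d =
     comp_expr a d @ comp_expr b (Suc d) @ [BinOp Mul (2 * d + 1) (2 * d + 1) (2 * d + 3)]"
| "comp_expr (At a) d = comp_expr a d @ [Load (2 * d + 1) (2 * d + 1)]"

fun len_expr :: "expr \<Rightarrow> nat" where
  "len_expr (Var x) = 1"
| "len_expr (Num k) = 1"
| "len_expr (Plus a b) = len_expr a + len_expr b + 1"
| "len_expr (Minus a b) = len_expr a + len_expr b + 1"
| "len_expr (Times a b) = len_expr a + len_expr b + 1"
| "len_expr (At a) = len_expr a + 1"

lemma length_comp_expr [simp]: "length (comp_expr e d) = len_expr e"
  by (induction e arbitrary: d) auto

fun len :: "com \<Rightarrow> nat" where
  "len Skip = 0"
| "len (x ::= e) = len_expr e + 1"
| "len (Write a b) = len_expr a + len_expr b + 1"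
| "len (c1 ;; c2) = len c1 + len c2"
| "len (If_Less a b c1 c2) = len_expr a + len_expr b + len c1 + len c2 + 2"
| "len (While_Less a b c) = len_expr a + len_expr b + len c + 3"

text \<open>Jump targets are absolute, hence the load address \<open>l\<close>; they can be computed
  in advance because \<open>len\<close> does not depend on it. \<open>Jump_Eq 1 1\<close> compares a
  register with itself and so always jumps. In a conditional the code for the false case comes
  first, since the machine jumps when the comparison holds.\<close>

fun compile :: "nat \<Rightarrow> com \<Rightarrow> program" where
  "compile l Skip = []"
| "compile l (x ::= e) = comp_expr e 0 @ [BinOp And (2 * x) 1 1]"
| "compile l (Write a b) = comp_expr a 0 @ comp_expr b 1 @ [Store 1 3]"
| "compile l (c1 ;; c2) = compile l c1 @ compile (l + len c1) c2"
| "compile l (If_Less a b c1 c2) =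
     (let l2 = l + len_expr a + len_expr b + 1; l1 = l2 + len c2 + 1
      in comp_expr a 0 @ comp_expr b 1 @ [Jump_Less 1 3 l1] @
         compile l2 c2 @ [Jump_Eq 1 1 (l1 + len c1)] @ compile l1 c1)"
| "compile l (While_Less a b c) =
     (let l' = l + len_expr a + len_expr b + 2
      in comp_expr a 0 @ comp_expr b 1 @ [Jump_Less 1 3 l', Jump_Eq 1 1 (l' + len c + 1)] @
         compile l' c @ [Jump_Eq 1 1 l])"

lemma length_comp [simp]: "length (compile l c) = len c"
  by (induction c arbitrary: l) (auto simp: Let_def)

fun eval :: "expr \<Rightarrow> state \<Rightarrow> nat" where
  "eval (Var x) (\<rho>, \<mu>) = \<rho> x"
| "eval (Num k) (\<rho>, \<mu>) = k"
| "eval (Plus a b) (\<rho>, \<mu>) = eval a (\<rho>, \<mu>) + eval b (\<rho>, \<mu>)"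
| "eval (Minus a b) (\<rho>, \<mu>) = eval a (\<rho>, \<mu>) - eval b (\<rho>, \<mu>)"
| "eval (Times a b) (\<rho>, \<mu>) = eval a (\<rho>, \<mu>) * eval b (\<rho>, \<mu>)"
| "eval (At a) (\<rho>, \<mu>) = \<mu> (eval a (\<rho>, \<mu>))"

text \<open>No intermediate result leaves the range of words, so evaluation over the natural numbers
  agrees with the machine.\<close>

fun safe :: "nat \<Rightarrow> expr \<Rightarrow> state \<Rightarrow> bool" where
  "safe w (Var x) (\<rho>, \<mu>) = True"
| "safe w (Num k) (\<rho>, \<mu>) = (k < 2 ^ w)"
| "safe w (Plus a b) (\<rho>, \<mu>) = (safe w a (\<rho>, \<mu>) \<and> safe w b (\<rho>, \<mu>) \<and>
     eval a (\<rho>, \<mu>) + eval b (\<rho>, \<mu>) < 2 ^ w)"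
| "safe w (Minus a b) (\<rho>, \<mu>) = (safe w a (\<rho>, \<mu>) \<and> safe w b (\<rho>, \<mu>) \<and>
     eval b (\<rho>, \<mu>) \<le> eval a (\<rho>, \<mu>))"
| "safe w (Times a b) (\<rho>, \<mu>) = (safe w a (\<rho>, \<mu>) \<and> safe w b (\<rho>, \<mu>) \<and>
     eval a (\<rho>, \<mu>) * eval b (\<rho>, \<mu>) < 2 ^ w)"
| "safe w (At a) (\<rho>, \<mu>) = safe w a (\<rho>, \<mu>)"

text \<open>Weakest preconditions of loop-free code; loops are covered by the rule \<open>wp_while\<close> instead.\<close>

fun pre :: "nat \<Rightarrow> com \<Rightarrow> (state \<Rightarrow> bool) \<Rightarrow> state \<Rightarrow> bool" where
  "pre w Skip Q s = Q s"
| "pre w (x ::= e) Q (\<rho>, \<mu>) = (safe w e (\<rho>, \<mu>) \<and> Q (\<rho>(x := eval e (\<rho>, \<mu>)), \<mu>))"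
| "pre w (Write a b) Q (\<rho>, \<mu>) = (safe w a (\<rho>, \<mu>) \<and> safe w b (\<rho>, \<mu>) \<and>
     Q (\<rho>, \<mu>(eval a (\<rho>, \<mu>) := eval b (\<rho>, \<mu>))))"
| "pre w (c1 ;; c2) Q s = pre w c1 (pre w c2 Q) s"
| "pre w (If_Less a b c1 c2) Q s = (safe w a s \<and> safe w b s \<and>
     (if eval a s < eval b s then pre w c1 Q s else pre w c2 Q s))"
| "pre w (While_Less a b c) Q s = False"

section \<open>Machine runs inside a larger program\<close>

definition code_at :: "program \<Rightarrow> nat \<Rightarrow> program \<Rightarrow> bool" where
  "code_at P l xs \<longleftrightarrow> (\<forall>i<length xs. l + i < length P \<and> P ! (l + i) = xs ! i)"

lemma code_at_Nil: "code_at P l []"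
  by (simp add: code_at_def)

lemma code_at_Cons:
  "code_at P l (x # xs) \<longleftrightarrow> l < length P \<and> P ! l = x \<and> code_at P (Suc l) xs"
  by (simp add: code_at_def All_less_Suc2)

lemma code_at_append:
  "code_at P l (xs @ ys) \<longleftrightarrow> code_at P l xs \<and> code_at P (l + length xs) ys"
  by (induction xs arbitrary: l) (simp_all add: code_at_Cons code_at_Nil)

definition words :: "nat \<Rightarrow> config \<Rightarrow> bool" where
  "words w c \<longleftrightarrow> (\<forall>r. regs c r < 2 ^ w) \<and> (\<forall>a. mem c a < 2 ^ w)"

definition reach :: "nat \<Rightarrow> program \<Rightarrow> config \<Rightarrow> nat \<Rightarrow> (config \<Rightarrow> bool) \<Rightarrow> bool" where
  "reach w P c T Q \<longleftrightarrow> (\<exists>k\<le>T. Q ((step w P ^^ k) c))"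

lemma reach_refl: "Q c \<Longrightarrow> reach w P c T Q"
  unfolding reach_def by (rule exI[of _ 0]) simp

lemma reach_mono: "reach w P c T Q \<Longrightarrow> T \<le> T' \<Longrightarrow> (\<And>c'. Q c' \<Longrightarrow> Q' c') \<Longrightarrow> reach w P c T' Q'"
  unfolding reach_def using le_trans by blast

lemma reach_trans:
  assumes "reach w P c T1 Q1" "\<And>c'. Q1 c' \<Longrightarrow> reach w P c' T2 Q2" "T1 + T2 \<le> T"
  shows "reach w P c T Q2"
proof -
  obtain k1 where k1: "k1 \<le> T1" "Q1 ((step w P ^^ k1) c)"
    using assms(1) unfolding reach_def by blast
  obtain k2 where k2: "k2 \<le> T2" "Q2 ((step w P ^^ k2) ((step w P ^^ k1) c))"
    using assms(2)[OF k1(2)] unfolding reach_def by blast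
  then have "Q2 ((step w P ^^ (k2 + k1)) c)"
    by (simp add: funpow_add)
  then show ?thesis
    unfolding reach_def using k1(1) k2(1) assms(3) by (intro exI[of _ "k2 + k1"]) auto
qed

lemma reach_step:
  assumes "pc c < length P" "reach w P (exec w (P ! pc c) c) T Q"
  shows "reach w P c (Suc T) Q"
proof -
  have "step w P c = exec w (P ! pc c) c"
    using assms(1) by (simp add: step_def halted_def)
  then have "reach w P c 1 (\<lambda>c'. c' = exec w (P ! pc c) c)"
    unfolding reach_def by (intro exI[of _ 1]) simp
  then show ?thesis
    by (rule reach_trans) (use assms(2) in auto)
qed

lemma reach_1: "pc c < length P \<Longrightarrow> Q (exec w (P ! pc c) c) \<Longrightarrow> reach w P c 1 Q"
  unfolding One_nat_def by (intro reach_step reach_refl)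

section \<open>Correctness of compiled expressions\<close>

definition state_of :: "config \<Rightarrow> state" where
  "state_of c = (\<lambda>x. regs c (2 * x), mem c)"

text \<open>The last clause is a frame condition: evaluation at stack level \<open>d\<close> leaves
  all variables (the even registers) and all intermediate results below level \<open>d\<close>
  alone. Without it the second operand could destroy the first.\<close>

definition expr_post :: "nat \<Rightarrow> config \<Rightarrow> expr \<Rightarrow> nat \<Rightarrow> nat \<Rightarrow> config \<Rightarrow> bool" where
  "expr_post w c e d l c' \<longleftrightarrow> pc c' = l + len_expr e \<and> words w c' \<and>
     regs c' (2 * d + 1) = eval e (state_of c) \<and> mem c' = mem c \<and>
     (\<forall>r. even r \<or> r < 2 * d + 1 \<longrightarrow> regs c' r = regs c r)"

lemma state_of_cong:
  assumes "mem c' = mem c" "\<And>r. even r \<Longrightarrow> regs c' r = regs c r"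
  shows "state_of c' = state_of c"
  using assms by (simp add: state_of_def)

text \<open>\<open>safe\<close> states no upper bound for \<open>Var\<close>, \<open>Minus\<close>
  and \<open>At\<close>: the first and the last read words from the machine, and a difference is
  bounded by its minuend.\<close>

lemma eval_less:
  assumes "words w c" "safe w e (state_of c)"
  shows "eval e (state_of c) < 2 ^ w"
  using assms by (induction e) (auto simp: words_def state_of_def)

lemma expr_post_words: "expr_post w c e d l c' \<Longrightarrow> words w c'"
  by (simp only: expr_post_def)

text \<open>The common part of the three arithmetic operations, which differ only in
  \<open>val\<close>, the equation saying that truncation to words does not change the
  result.\<close>

lemma expr_binop:
  assumes a: "reach w P c (len_expr a) (expr_post w c a d l)"
    and b: "\<And>c'. expr_post w c a d l c' \<Longrightarrow>
      reach w P c' (len_expr b) (expr_post w c' b (Suc d) (l + len_expr a))"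
    and code: "code_at P (l + len_expr a + len_expr b) [BinOp f (2 * d + 1) (2 * d + 1) (2 * d + 3)]"
    and len: "len_expr e = len_expr a + len_expr b + 1"
    and val: "take_bit w (binop_val w f (eval a (state_of c)) (eval b (state_of c))) = eval e (state_of c)"
  shows "reach w P c (len_expr e) (expr_post w c e d l)"
proof (rule reach_trans[OF a])
  fix c1 assume c1: "expr_post w c a d l c1"
  have st: "state_of c1 = state_of c"
    using c1 by (intro state_of_cong) (auto simp: expr_post_def)
  show "reach w P c1 (len_expr b + 1) (expr_post w c e d l)"
  proof (rule reach_trans[OF b[OF c1]])
    fix c2 assume c2: "expr_post w c1 b (Suc d) (l + len_expr a) c2"
    show "reach w P c2 1 (expr_post w c e d l)"
    proof (rule reach_1)
      show "pc c2 < length P"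
        using code c2 by (simp add: code_at_Cons expr_post_def)
      have *: "P ! pc c2 = BinOp f (2 * d + 1) (2 * d + 1) (2 * d + 3)"
        using code c2 by (simp add: code_at_Cons expr_post_def)
      have "regs c2 (2 * Suc d + 1) = eval b (state_of c1)" "regs c2 (2 * d + 1) = regs c1 (2 * d + 1)"
        using c2 by (simp_all add: expr_post_def)
      then have r: "regs c2 (2 * d + 3) = eval b (state_of c)" "regs c2 (2 * d + 1) = eval a (state_of c)"
        using c1 st by (simp_all add: expr_post_def eval_nat_numeral)
      have "exec w (P ! pc c2) c2 = set_reg (2 * d + 1) (eval e (state_of c)) c2" (is "_ = ?c")
        by (simp only: * exec.simps r val)
      moreover have "pc ?c = l + len_expr e" "mem ?c = mem c" "regs ?c (2 * d + 1) = eval e (state_of c)"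
        using c1 c2 len by (simp_all add: expr_post_def set_reg_def)
      moreover have "words w ?c"
        using c2 val[symmetric] by (auto simp: set_reg_def words_def dest: expr_post_words[unfolded words_def])
      moreover have "regs ?c r = regs c r" if "even r \<or> r < 2 * d + 1" for r
      proof -
        have "r \<noteq> 2 * d + 1" "even r \<or> r < 2 * Suc d + 1"
          using that by auto
        moreover from this have "regs c2 r = regs c1 r"
          using c2 unfolding expr_post_def by blast
        moreover have "regs c1 r = regs c r"
          using c1 that unfolding expr_post_def by blast
        ultimately show ?thesis
          by (simp add: set_reg_def)
      qed
      ultimately show "expr_post w c e d l (exec w (P ! pc c2) c2)"
        by (simp add: expr_post_def)
    qed
  qed simp
qed (simp add: len)

lemma comp_expr_correct:
  assumes "code_at P l (comp_expr e d)" "pc c = l" "words w c" "safe w e (state_of c)"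
  shows "reach w P c (len_expr e) (expr_post w c e d l)"
  using assms
proof (induction e arbitrary: d l c)
  case (Var x)
  \<comment> \<open>The machine has no copy instruction; \<open>And\<close> of a register with
    itself does this job, and truncation is harmless because registers hold words.\<close>
  then have "take_bit w (regs c (2 * x)) = regs c (2 * x)"
    by (simp add: words_def take_bit_nat_eq_self_iff)
  with Var show ?case
    unfolding len_expr.simps
    by (intro reach_1) (auto simp: code_at_Cons expr_post_def set_reg_def words_def state_of_def)
next
  case (Num k)
  then have "take_bit w k = k"
    by (simp add: take_bit_nat_eq_self_iff state_of_def)
  with Num show ?case
    unfolding len_expr.simps
    by (intro reach_1) (auto simp: code_at_Cons expr_post_def set_reg_def words_def state_of_def)
next
  case (Plus a b)
  show ?case
  proof (rule expr_binop[where a = a and b = b and f = Add])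
    fix c' assume c': "expr_post w c a d l c'"
    then have "state_of c' = state_of c"
      by (intro state_of_cong) (auto simp: expr_post_def)
    with Plus.prems c' show "reach w P c' (len_expr b) (expr_post w c' b (Suc d) (l + len_expr a))"
      by (intro Plus.IH) (auto simp: code_at_append expr_post_def state_of_def)
  next
    show "reach w P c (len_expr a) (expr_post w c a d l)"
      using Plus.prems by (intro Plus.IH(1)) (auto simp: code_at_append state_of_def)
  qed (use Plus.prems in \<open>auto simp: code_at_append state_of_def take_bit_nat_eq_self_iff add.assoc\<close>)
next
  case (Minus a b)
  show ?case
  proof (rule expr_binop[where a = a and b = b and f = Sub])
    fix c' assume c': "expr_post w c a d l c'"
    then have "state_of c' = state_of c"
      by (intro state_of_cong) (auto simp: expr_post_def)
    with Minus.prems c' show "reach w P c' (len_expr b) (expr_post w c' b (Suc d) (l + len_expr a))"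
      by (intro Minus.IH) (auto simp: code_at_append expr_post_def state_of_def)
  next
    let ?a = "eval a (state_of c)" and ?b = "eval b (state_of c)"
    have "?b \<le> ?a" using Minus.prems by (simp add: state_of_def)
    moreover have "?a < 2 ^ w" using Minus.prems by (intro eval_less) (auto simp: state_of_def)
    ultimately have "?a + 2 ^ w - ?b = ?a - ?b + 2 ^ w" "?a - ?b < 2 ^ w"
      by auto
    then have "(?a + 2 ^ w - ?b) mod 2 ^ w = ?a - ?b"
      by (metis mod_add_self2 mod_less)
    then have "take_bit w (binop_val w Sub ?a ?b) = ?a - ?b"
      by (simp only: binop_val.simps take_bit_eq_mod)
    then show "take_bit w (binop_val w Sub ?a ?b) = eval (Minus a b) (state_of c)"
      by (simp add: state_of_def)
  next
    show "reach w P c (len_expr a) (expr_post w c a d l)"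
      using Minus.prems by (intro Minus.IH(1)) (auto simp: code_at_append state_of_def)
  qed (use Minus.prems in \<open>auto simp: code_at_append state_of_def add.assoc\<close>)
next
  case (Times a b)
  show ?case
  proof (rule expr_binop[where a = a and b = b and f = Mul])
    fix c' assume c': "expr_post w c a d l c'"
    then have "state_of c' = state_of c"
      by (intro state_of_cong) (auto simp: expr_post_def)
    with Times.prems c' show "reach w P c' (len_expr b) (expr_post w c' b (Suc d) (l + len_expr a))"
      by (intro Times.IH) (auto simp: code_at_append expr_post_def state_of_def)
  next
    show "reach w P c (len_expr a) (expr_post w c a d l)"
      using Times.prems by (intro Times.IH(1)) (auto simp: code_at_append state_of_def)
  qed (use Times.prems in \<open>auto simp: code_at_append state_of_def take_bit_nat_eq_self_iff add.assoc\<close>)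
next
  case (At a)
  show ?case
  proof (rule reach_trans)
    show "reach w P c (len_expr a) (expr_post w c a d l)"
      using At.prems by (intro At.IH) (auto simp: code_at_append state_of_def)
  next
    fix c' assume "expr_post w c a d l c'"
    then show "reach w P c' 1 (expr_post w c (At a) d l)"
      using At.prems
      by (intro reach_1)
        (auto simp: expr_post_def set_reg_def words_def state_of_def code_at_append code_at_Cons)
  qed simp
qed

lemma comp_pair_correct:
  assumes "code_at P l (comp_expr a 0 @ comp_expr b 1)" "pc c = l" "words w c"
    "safe w a (state_of c)" "safe w b (state_of c)"
  shows "reach w P c (len_expr a + len_expr b)
     (\<lambda>c'. pc c' = l + len_expr a + len_expr b \<and> words w c' \<and> regs c' 1 = eval a (state_of c) \<and>
       regs c' 3 = eval b (state_of c) \<and> state_of c' = state_of c)"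
proof (rule reach_trans[where ?T1.0 = "len_expr a"])
  show "reach w P c (len_expr a) (expr_post w c a 0 l)"
    using assms by (intro comp_expr_correct) (auto simp: code_at_append)
next
  fix c1 assume c1: "expr_post w c a 0 l c1"
  then have st: "state_of c1 = state_of c"
    by (intro state_of_cong) (auto simp: expr_post_def)
  have *: "reach w P c1 (len_expr b) (expr_post w c1 b 1 (l + len_expr a))"
    using assms c1 st by (intro comp_expr_correct) (auto simp: code_at_append expr_post_def)
  show "reach w P c1 (len_expr b)
     (\<lambda>c'. pc c' = l + len_expr a + len_expr b \<and> words w c' \<and> regs c' 1 = eval a (state_of c) \<and>
       regs c' 3 = eval b (state_of c) \<and> state_of c' = state_of c)"
  proof (rule reach_mono[OF *])
    fix c2 assume c2: "expr_post w c1 b 1 (l + len_expr a) c2"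
    then have "state_of c2 = state_of c1"
      by (intro state_of_cong) (auto simp: expr_post_def)
    with c1 c2 st show "pc c2 = l + len_expr a + len_expr b \<and> words w c2 \<and>
       regs c2 1 = eval a (state_of c) \<and> regs c2 3 = eval b (state_of c) \<and> state_of c2 = state_of c"
      by (auto simp: expr_post_def)
  qed simp
qed simp

text \<open>Quantifying over every program \<open>P\<close> that contains the code, at any address
  \<open>l\<close>, makes the notion compositional. Termination within \<open>T\<close> steps is
  part of it.\<close>

definition wp :: "nat \<Rightarrow> com \<Rightarrow> nat \<Rightarrow> (state \<Rightarrow> bool) \<Rightarrow> state \<Rightarrow> bool" where
  "wp w C T Q s \<longleftrightarrow> (\<forall>P l c. code_at P l (compile l C) \<longrightarrow> pc c = l \<longrightarrow> words w c \<longrightarrow> state_of c = s \<longrightarrow>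
     reach w P c T (\<lambda>c'. pc c' = l + len C \<and> words w c' \<and> Q (state_of c')))"

lemma wpD:
  assumes "wp w C T Q s" "code_at P l (compile l C)" "pc c = l" "words w c" "state_of c = s"
  shows "reach w P c T (\<lambda>c'. pc c' = l + len C \<and> words w c' \<and> Q (state_of c'))"
  using assms unfolding wp_def by blast

lemma wp_mono:
  assumes "wp w C T Q s" "T \<le> T'" "\<And>s'. Q s' \<Longrightarrow> Q' s'"
  shows "wp w C T' Q' s"
  unfolding wp_def
proof (intro allI impI)
  fix P l c
  assume *: "code_at P l (compile l C)" "pc c = l" "words w c" "state_of c = s"
  show "reach w P c T' (\<lambda>c'. pc c' = l + len C \<and> words w c' \<and> Q' (state_of c'))"
    by (rule reach_mono[OF assms(1)[unfolded wp_def, rule_format, OF *] assms(2)])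
      (use assms(3) in auto)
qed

lemma wp_seq:
  assumes "wp w C1 T1 R s" "\<And>s'. R s' \<Longrightarrow> wp w C2 T2 Q s'"
  shows "wp w (C1 ;; C2) (T1 + T2) Q s"
  unfolding wp_def
proof (intro allI impI)
  fix P l c
  assume *: "code_at P l (compile l (C1 ;; C2))" "pc c = l" "words w c" "state_of c = s"
  then have code: "code_at P l (compile l C1)" "code_at P (l + len C1) (compile (l + len C1) C2)"
    by (auto simp: code_at_append)
  show "reach w P c (T1 + T2) (\<lambda>c'. pc c' = l + len (C1 ;; C2) \<and> words w c' \<and> Q (state_of c'))"
  proof (rule reach_trans[OF assms(1)[unfolded wp_def, rule_format, OF code(1) *(2-4)]])
    fix c' assume "pc c' = l + len C1 \<and> words w c' \<and> R (state_of c')"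
    then have "reach w P c' T2 (\<lambda>c''. pc c'' = l + len C1 + len C2 \<and> words w c'' \<and> Q (state_of c''))"
      using assms(2)[of "state_of c'"] code(2) unfolding wp_def by blast
    then show "reach w P c' T2 (\<lambda>c'. pc c' = l + len (C1 ;; C2) \<and> words w c' \<and> Q (state_of c'))"
      by (simp add: add.assoc)
  qed simp
qed

lemma wp_if:
  assumes "safe w a s" "safe w b s"
    "if eval a s < eval b s then wp w C1 T Q s else wp w C2 T Q s"
  shows "wp w (If_Less a b C1 C2) (len_expr a + len_expr b + T + 2) Q s"
  unfolding wp_def
proof (intro allI impI)
  fix P l c
  assume *: "code_at P l (compile l (If_Less a b C1 C2))" "pc c = l" "words w c" "state_of c = s"
  define j where "j = l + len_expr a + len_expr b"
  define l1 where "l1 = Suc (Suc (j + len C2))"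
  let ?Q = "\<lambda>c'. pc c' = l + len (If_Less a b C1 C2) \<and> words w c' \<and> Q (state_of c')"
  have code: "code_at P l (comp_expr a 0 @ comp_expr b 1)" "code_at P (Suc j) (compile (Suc j) C2)"
     "code_at P l1 (compile l1 C1)"
    and jmp: "j < length P" "P ! j = Jump_Less 1 3 l1" "Suc (j + len C2) < length P"
      "P ! Suc (j + len C2) = Jump_Eq 1 1 (l1 + len C1)"
    using *(1) by (auto simp: code_at_append code_at_Cons Let_def j_def l1_def add.assoc)
  have end_eq: "l + len (If_Less a b C1 C2) = l1 + len C1"
    by (simp add: l1_def j_def)
  show "reach w P c (len_expr a + len_expr b + T + 2) ?Q"
  proof (rule reach_trans[OF comp_pair_correct[OF code(1) *(2,3)]])
    fix c1
    assume c1: "pc c1 = l + len_expr a + len_expr b \<and> words w c1 \<and> regs c1 1 = eval a (state_of c) \<and>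
       regs c1 3 = eval b (state_of c) \<and> state_of c1 = state_of c"
    let ?c = "exec w (P ! pc c1) c1"
    have st: "state_of ?c = s" "words w ?c"
      using c1 jmp *(4) by (auto simp: state_of_def words_def j_def)
    have "reach w P ?c (Suc T) ?Q"
    proof (cases "eval a s < eval b s")
      case True
      then have "pc ?c = l1"
        using c1 jmp *(4) by (simp add: j_def)
      then have "reach w P ?c T ?Q"
        unfolding end_eq using assms(3) True code(3) st by (intro wpD) auto
      then show ?thesis
        by (rule reach_mono) auto
    next
      case False
      then have "pc ?c = Suc j"
        using c1 jmp *(4) by (simp add: j_def)
      then have "reach w P ?c T (\<lambda>c'. pc c' = Suc j + len C2 \<and> words w c' \<and> Q (state_of c'))"
        using assms(3) False code(2) st by (intro wpD) auto
      then show ?thesis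
      proof (rule reach_trans[where ?T2.0 = 1])
        fix c' assume "pc c' = Suc j + len C2 \<and> words w c' \<and> Q (state_of c')"
        then show "reach w P c' 1 ?Q"
          unfolding end_eq using jmp
          by (intro reach_1) (auto simp: words_def state_of_def)
      qed simp
    qed
    moreover have "pc c1 < length P"
      using c1 jmp(1) by (simp add: j_def)
    ultimately have "reach w P c1 (Suc (Suc T)) ?Q"
      by (rule reach_step[rotated])
    then show "reach w P c1 (T + 2) ?Q"
      by simp
  qed (use assms(1,2) *(4) in auto)
qed

text \<open>The potential \<open>V\<close> drops in every round, so at most \<open>V s + 1\<close>
  tests are made, and each is charged a full round. A potential that combines several variables thus
  yields amortised bounds. The additive 2 pays for the conditional jump and for the jump back or
  out.\<close>

lemma wp_while:
  assumes inv: "I s"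
    and body: "\<And>s. I s \<Longrightarrow> safe w a s \<and> safe w b s \<and>
      (if eval a s < eval b s then wp w C T (\<lambda>s'. I s' \<and> V s' < V s) s else Q s)"
  shows "wp w (While_Less a b C) ((V s + 1) * (len_expr a + len_expr b + T + 2)) Q s"
  unfolding wp_def
proof (intro allI impI)
  fix P l c
  let ?W = "While_Less a b C"
  let ?Q = "\<lambda>c'. pc c' = l + len ?W \<and> words w c' \<and> Q (state_of c')"
  define T' where "T' = len_expr a + len_expr b + T + 2"
  define j where "j = l + len_expr a + len_expr b"
  assume code: "code_at P l (compile l ?W)"
  then have code1: "code_at P l (comp_expr a 0 @ comp_expr b 1)" "code_at P (Suc (Suc j)) (compile (Suc (Suc j)) C)"
    and jmp: "j < length P" "P ! j = Jump_Less 1 3 (Suc (Suc j))" "Suc j < length P"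
      "P ! Suc j = Jump_Eq 1 1 (l + len ?W)" "Suc (Suc (j + len C)) < length P"
      "P ! Suc (Suc (j + len C)) = Jump_Eq 1 1 l"
    by (auto simp: code_at_append code_at_Cons Let_def j_def add.assoc eval_nat_numeral)
  have main: "pc c = l \<Longrightarrow> words w c \<Longrightarrow> I (state_of c) \<Longrightarrow>
      reach w P c ((V (state_of c) + 1) * T') ?Q" for c
  proof (induction "V (state_of c)" arbitrary: c rule: less_induct)
    case less
    let ?s = "state_of c"
    note b = body[OF less.prems(3)]
    show ?case
    proof (cases "eval a ?s < eval b ?s")
      case True
      show ?thesis
      proof (rule reach_trans[OF comp_pair_correct[OF code1(1) less.prems(1,2)], where ?T2.0 = "Suc (Suc T) + V ?s * T'"])
        fix c1
        assume c1: "pc c1 = l + len_expr a + len_expr b \<and> words w c1 \<and> regs c1 1 = eval a ?s \<and>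
          regs c1 3 = eval b ?s \<and> state_of c1 = ?s"
        let ?c = "exec w (P ! pc c1) c1"
        have st: "state_of ?c = ?s" "words w ?c" "pc ?c = Suc (Suc j)"
          using c1 jmp True by (auto simp: state_of_def words_def j_def)
        have "reach w P ?c T (\<lambda>c'. pc c' = Suc (Suc j) + len C \<and> words w c' \<and>
            (I (state_of c') \<and> V (state_of c') < V ?s))"
          using b True code1(2) st by (intro wpD) auto
        then have "reach w P ?c (Suc T + V ?s * T') ?Q"
        proof (rule reach_trans[where ?T2.0 = "Suc (V ?s * T')"])
          fix c2 assume c2: "pc c2 = Suc (Suc j) + len C \<and> words w c2 \<and>
            (I (state_of c2) \<and> V (state_of c2) < V ?s)"
          let ?d = "exec w (P ! pc c2) c2"
          have d: "pc ?d = l" "words w ?d" "state_of ?d = state_of c2"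
            using c2 jmp by (auto simp: words_def state_of_def)
          have "reach w P ?d ((V (state_of ?d) + 1) * T') ?Q"
            using c2 d by (intro less.hyps) auto
          then have "reach w P ?d (V ?s * T') ?Q"
            by (rule reach_mono) (rule mult_le_mono1, use c2 d in auto)
          then show "reach w P c2 (Suc (V ?s * T')) ?Q"
            using c2 jmp by (intro reach_step) auto
        qed simp
        moreover have "pc c1 < length P"
          using c1 jmp(1) by (simp add: j_def)
        ultimately show "reach w P c1 (Suc (Suc T) + V ?s * T') ?Q"
          unfolding add_Suc by (rule reach_step[rotated])
      qed (use b in \<open>auto simp: T'_def\<close>)
    next
      case False
      have "reach w P c (len_expr a + len_expr b + 2) ?Q"
      proof (rule reach_trans[OF comp_pair_correct[OF code1(1) less.prems(1,2)], where ?T2.0 = 2])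
        fix c1
        assume c1: "pc c1 = l + len_expr a + len_expr b \<and> words w c1 \<and> regs c1 1 = eval a ?s \<and>
          regs c1 3 = eval b ?s \<and> state_of c1 = ?s"
        have "Q ?s" using b False by simp
        then show "reach w P c1 2 ?Q"
          unfolding numeral_2_eq_2 using c1 jmp False
          by (intro reach_step reach_1[unfolded One_nat_def]) (auto simp: j_def words_def state_of_def)
      qed (use b in auto)
      then show ?thesis
        by (rule reach_mono) (auto simp: T'_def)
    qed
  qed
  assume "pc c = l" "words w c" "state_of c = s"
  then show "reach w P c ((V s + 1) * (len_expr a + len_expr b + T + 2)) ?Q"
    using main[of c] inv unfolding T'_def by simp
qed

text \<open>Both branches of a conditional are charged, and the clause for loops is a dummy.\<close>

fun cost :: "com \<Rightarrow> nat" where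
  "cost Skip = 0"
| "cost (x ::= e) = len_expr e + 1"
| "cost (Write a b) = len_expr a + len_expr b + 1"
| "cost (c1 ;; c2) = cost c1 + cost c2"
| "cost (If_Less a b c1 c2) = len_expr a + len_expr b + (cost c1 + cost c2) + 2"
| "cost (While_Less a b c) = 0"

lemma pre_wp: "pre w C Q s \<Longrightarrow> wp w C (cost C) Q s"
proof (induction C arbitrary: Q s)
  case Skip
  then show ?case by (auto simp: wp_def intro!: reach_refl)
next
  case (Assign x e)
  obtain \<rho> \<mu> where s: "s = (\<rho>, \<mu>)" by fastforce
  show ?case
    unfolding wp_def
  proof (intro allI impI)
    fix P l c
    assume *: "code_at P l (compile l (x ::= e))" "pc c = l" "words w c" "state_of c = s"
    have "reach w P c (len_expr e) (expr_post w c e 0 l)"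
      using * Assign s by (intro comp_expr_correct) (auto simp: code_at_append)
    then show "reach w P c (cost (x ::= e)) (\<lambda>c'. pc c' = l + len (x ::= e) \<and> words w c' \<and> Q (state_of c'))"
    proof (rule reach_trans[where ?T2.0 = 1])
      fix c' assume c': "expr_post w c e 0 l c'"
      have lt: "eval e s < 2 ^ w"
        using eval_less[OF *(3)] *(4) Assign s by simp
      then have tb: "take_bit w (eval e s) = eval e s"
        by (simp add: take_bit_nat_eq_self_iff)
      have "state_of (c'\<lparr>pc := Suc (pc c'), regs := (regs c')(2 * x := eval e s)\<rparr>) =
        (\<rho>(x := eval e (\<rho>, \<mu>)), \<mu>)"
        using c' *(4) s by (auto simp: state_of_def expr_post_def fun_eq_iff)
      then show "reach w P c' 1 (\<lambda>c'. pc c' = l + len (x ::= e) \<and> words w c' \<and> Q (state_of c'))"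
        using c' * Assign s tb lt
        by (intro reach_1)
          (auto simp: code_at_append code_at_Cons expr_post_def set_reg_def words_def)
    qed simp
  qed
next
  case (Write a b)
  obtain \<rho> \<mu> where s: "s = (\<rho>, \<mu>)" by fastforce
  show ?case
    unfolding wp_def
  proof (intro allI impI)
    fix P l c
    assume *: "code_at P l (compile l (Write a b))" "pc c = l" "words w c" "state_of c = s"
    then have code: "code_at P l (comp_expr a 0 @ comp_expr b 1)"
      by (auto simp: code_at_append)
    show "reach w P c (cost (Write a b)) (\<lambda>c'. pc c' = l + len (Write a b) \<and> words w c' \<and> Q (state_of c'))"
    proof (rule reach_trans[OF comp_pair_correct[OF code *(2,3)], where ?T2.0 = 1])
      fix c' assume c': "pc c' = l + len_expr a + len_expr b \<and> words w c' \<and> regs c' 1 = eval a (state_of c) \<and>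
       regs c' 3 = eval b (state_of c) \<and> state_of c' = state_of c"
      have lt: "eval b s < 2 ^ w"
        using eval_less[OF *(3)] *(4) Write s by simp
      from c' have "state_of (c'\<lparr>pc := Suc (pc c'), mem := (mem c')(eval a s := eval b s)\<rparr>) =
        (\<rho>, \<mu>(eval a s := eval b s))"
        using *(4) s by (auto simp: state_of_def)
      then show "reach w P c' 1 (\<lambda>c'. pc c' = l + len (Write a b) \<and> words w c' \<and> Q (state_of c'))"
        using c' * Write s lt
        by (intro reach_1) (auto simp: code_at_append code_at_Cons words_def add.assoc)
    qed (use Write s *(4) in auto)
  qed
next
  case (Seq C1 C2)
  then show ?case
    unfolding cost.simps by (intro wp_seq[where R = "pre w C2 Q"]) auto
next
  case (If_Less a b C1 C2)
  have "if eval a s < eval b s then wp w C1 (cost C1 + cost C2) Q s else wp w C2 (cost C1 + cost C2) Q s"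
    using If_Less.IH[of Q s] If_Less.prems
    by (auto intro: wp_mono[where T = "cost C1"] wp_mono[where T = "cost C2"])
  with If_Less.prems show ?case
    unfolding cost.simps by (intro wp_if) auto
next
  case (While_Less a b C)
  then show ?case by simp
qed

section \<open>Order-isomorphic windows\<close>

text \<open>Strings are functions here, so a window is merely an offset \<open>i\<close>, and the
  same notion serves for the text and for the pattern against itself.\<close>

definition isomorphic_at :: "(nat \<Rightarrow> nat) \<Rightarrow> (nat \<Rightarrow> nat) \<Rightarrow> nat \<Rightarrow> nat \<Rightarrow> bool" where
  "isomorphic_at p s i k \<longleftrightarrow> (\<forall>a b. a < b \<and> b < k \<longrightarrow> (s (i + b) < s (i + a) \<longleftrightarrow> p b < p a))"

lemma iso_mono: "isomorphic_at p s i k \<Longrightarrow> k' \<le> k \<Longrightarrow> isomorphic_at p s i k'"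
  unfolding isomorphic_at_def by (meson less_le_trans)

lemma iso_0 [simp]: "isomorphic_at p s i 0"
  by (simp add: isomorphic_at_def)

text \<open>Inside the matched window every comparison in \<open>s\<close> can be replaced by the
  one in \<open>p\<close> at the same offsets. Hence shifts can be computed from the pattern
  alone.\<close>

lemma iso_suffix:
  assumes "isomorphic_at p s i q" "d + k \<le> q"
  shows "isomorphic_at p s (i + d) k \<longleftrightarrow> isomorphic_at p p d k"
proof -
  have "s (i + d + b) < s (i + d + a) \<longleftrightarrow> p (d + b) < p (d + a)" if "a < b" "b < k" for a b
    using assms that unfolding isomorphic_at_def by (simp add: add.assoc)
  then show ?thesis
    unfolding isomorphic_at_def by blast
qed

text \<open>The conclusion is weak because \<open>isomorphic_at\<close> only asks whether the later
  entry is smaller, which for \<open>a < b\<close> does not rule out equal entries of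
  \<open>s\<close>.\<close>

lemma iso_le:
  assumes "isomorphic_at p s i q" "a < q" "b < q" "p a < p b"
  shows "s (i + a) \<le> s (i + b)"
proof (rule linorder_cases[of a b])
  assume "a < b"
  then show ?thesis using assms unfolding isomorphic_at_def by (meson not_le less_asym)
next
  assume "b < a"
  then show ?thesis using assms unfolding isomorphic_at_def by (metis less_imp_le)
qed simp

text \<open>The failure function of Knuth, Morris and Pratt: \<open>k\<close> is the length of the longest proper
  suffix of \<open>p 0, \<dots>, p (q - 1)\<close> that is order-isomorphic to a prefix.\<close>

definition border :: "(nat \<Rightarrow> nat) \<Rightarrow> nat \<Rightarrow> nat \<Rightarrow> bool" where
  "border p q k \<longleftrightarrow> k < q \<and> isomorphic_at p p (q - k) k \<and> (\<forall>d. 0 < d \<and> d < q - k \<longrightarrow> \<not> isomorphic_at p p d (q - d))"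

lemma iso_shift:
  assumes "isomorphic_at p s i q" "border p q k"
  shows "isomorphic_at p s (i + q - k) k"
proof -
  have "k < q" "isomorphic_at p p (q - k) k"
    using assms(2) unfolding border_def by blast+
  with iso_suffix[OF assms(1), of "q - k" k] show ?thesis
    by simp
qed

text \<open>A skipped start \<open>d\<close> whose window still reached the end of the current one
  would, by \<open>iso_suffix\<close>, match the pattern against itself shifted by
  \<open>d - i < q - k\<close>, contradicting the maximality in \<open>border\<close>.\<close>

lemma not_iso_between:
  assumes "isomorphic_at p s i q" "border p q k" "i < d" "d < i + q - k"
  shows "\<not> isomorphic_at p s d (i + q - d)"
proof -
  have "0 < d - i" "d - i < q - k"
    using assms(3,4) by auto
  then have "\<not> isomorphic_at p p (d - i) (q - (d - i))"
    using assms(2) unfolding border_def by blast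
  moreover have "isomorphic_at p s (i + (d - i)) (q - (d - i)) \<longleftrightarrow> isomorphic_at p p (d - i) (q - (d - i))"
    using assms(3,4) by (intro iso_suffix[OF assms(1)]) auto
  moreover have "i + (d - i) = d" "q - (d - i) = i + q - d"
    using assms(3,4) by auto
  ultimately show ?thesis
    by simp
qed

text \<open>Indices are shifted by one, so that 0 can stand for a missing neighbour.\<close>

definition lower :: "(nat \<Rightarrow> nat) \<Rightarrow> nat \<Rightarrow> nat \<Rightarrow> bool" where
  "lower p q l \<longleftrightarrow> l \<le> q \<and> (0 < l \<longrightarrow> p (l - 1) < p q) \<and>
     (\<forall>a<q. p a < p q \<longrightarrow> 0 < l \<and> p a \<le> p (l - 1))"

definition upper :: "(nat \<Rightarrow> nat) \<Rightarrow> nat \<Rightarrow> nat \<Rightarrow> bool" where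
  "upper p q r \<longleftrightarrow> r \<le> q \<and> (0 < r \<longrightarrow> p q < p (r - 1)) \<and>
     (\<forall>a<q. p q < p a \<longrightarrow> 0 < r \<and> p (r - 1) \<le> p a)"

text \<open>The old entries are already ordered correctly, so an entry below \<open>p q\<close> lies
  at or below \<open>p (l - 1)\<close>, and its image lies at or below \<open>s (i + l - 1)\<close>.
  One comparison with that image decides for all of them, and likewise above. Injectivity of
  \<open>s\<close> turns the weak inequalities into strict ones where this is needed.\<close>

lemma iso_extend:
  assumes iso: "isomorphic_at p s i q" and l: "lower p q l" and r: "upper p q r"
    and inj: "inj_on p {..q}" "inj_on s {i..i + q}"
  shows "isomorphic_at p s i (Suc q) \<longleftrightarrow>
    \<not> (0 < l \<and> s (i + q) < s (i + l - 1)) \<and> \<not> (0 < r \<and> s (i + r - 1) < s (i + q))"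
proof -
  have inj_p: "p a = p b \<longleftrightarrow> a = b" if "a \<le> q" "b \<le> q" for a b
    using inj(1) that by (auto dest: inj_onD)
  have inj_s: "s (i + a) = s (i + b) \<longleftrightarrow> a = b" if "a \<le> q" "b \<le> q" for a b
    using inj(2) that by (auto dest: inj_onD)
  have le: "s (i + a) \<le> s (i + b)" if "a < q" "b < q" "p a \<le> p b" for a b
    using iso_le[OF iso, of a b] that inj_p[of a b] by (cases "a = b") auto
  have suc: "isomorphic_at p s i (Suc q) \<longleftrightarrow> (\<forall>a<q. s (i + q) < s (i + a) \<longleftrightarrow> p q < p a)"
    using iso unfolding isomorphic_at_def by (auto simp: less_Suc_eq)
  show ?thesis
  proof
    assume "isomorphic_at p s i (Suc q)"
    then have ext: "s (i + q) < s (i + a) \<longleftrightarrow> p q < p a" if "a < q" for a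
      using suc that by blast
    have "\<not> s (i + q) < s (i + l - 1)" if "0 < l"
    proof -
      have "l - 1 < q" "p (l - 1) < p q"
        using l that by (auto simp: lower_def)
      then show ?thesis
        using ext[of "l - 1"] that by simp
    qed
    moreover have "\<not> s (i + r - 1) < s (i + q)" if "0 < r"
    proof -
      have "r - 1 < q" "p q < p (r - 1)"
        using r that by (auto simp: upper_def)
      then show ?thesis
        using ext[of "r - 1"] that inj_s[of "r - 1" q] by simp
    qed
    ultimately show "\<not> (0 < l \<and> s (i + q) < s (i + l - 1)) \<and> \<not> (0 < r \<and> s (i + r - 1) < s (i + q))"
      by blast
  next
    assume *: "\<not> (0 < l \<and> s (i + q) < s (i + l - 1)) \<and> \<not> (0 < r \<and> s (i + r - 1) < s (i + q))"
    show "isomorphic_at p s i (Suc q)"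
      unfolding suc
    proof (intro allI impI)
      fix a assume a: "a < q"
      consider "p a < p q" | "p q < p a"
        using inj_p[of a q] a by fastforce
      then show "s (i + q) < s (i + a) \<longleftrightarrow> p q < p a"
      proof cases
        case 1
        then have "0 < l" "p a \<le> p (l - 1)" "l - 1 < q"
          using l a by (auto simp: lower_def)
        then have "s (i + a) \<le> s (i + q)"
          using le[of a "l - 1"] a * by auto
        with 1 show ?thesis by auto
      next
        case 2
        then have "0 < r" "p (r - 1) \<le> p a" "r - 1 < q"
          using r a by (auto simp: upper_def)
        then have "s (i + q) \<le> s (i + a)"
          using le[of "r - 1" a] a * by auto
        with 2 show ?thesis using inj_s[of a q] a by auto
      qed
    qed
  qed
qed

section \<open>Linked lists of values\<close>

text \<open>The values 0 and \<open>Suc n\<close> are sentinels at the two ends, so every member has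
  a neighbour on either side.\<close>

definition adjacent :: "nat \<Rightarrow> nat set \<Rightarrow> nat \<Rightarrow> nat \<Rightarrow> bool" where
  "adjacent n S u v \<longleftrightarrow> u < v \<and> u \<in> insert 0 S \<and> v \<in> insert (Suc n) S \<and> (\<forall>x\<in>S. \<not> (u < x \<and> x < v))"

text \<open>Only adjacent pairs are constrained: deleted values keep stale pointers, which is why a
  deletion takes just two updates.\<close>

definition linked :: "nat \<Rightarrow> nat set \<Rightarrow> (nat \<Rightarrow> nat) \<Rightarrow> (nat \<Rightarrow> nat) \<Rightarrow> bool" where
  "linked n S pr su \<longleftrightarrow> S \<subseteq> {1..n} \<and> (\<forall>u v. adjacent n S u v \<longrightarrow> su u = v \<and> pr v = u)"

lemma linkedI:
  "S \<subseteq> {1..n} \<Longrightarrow> (\<And>u v. adjacent n S u v \<Longrightarrow> su u = v \<and> pr v = u) \<Longrightarrow> linked n S pr su"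
  by (simp add: linked_def)

lemma linked_range: "linked n S pr su \<Longrightarrow> S \<subseteq> {1..n}"
  unfolding linked_def by blast

lemma linked_adjacent: "linked n S pr su \<Longrightarrow> adjacent n S u v \<Longrightarrow> su u = v \<and> pr v = u"
  unfolding linked_def by blast

lemma adjacent_range: "S \<subseteq> {1..n} \<Longrightarrow> adjacent n S u v \<Longrightarrow> u \<le> n \<and> v \<le> Suc n"
  by (auto simp: adjacent_def)

lemma linked_cong:
  assumes "linked n S pr su" "\<And>v. v \<le> Suc n \<Longrightarrow> pr' v = pr v" "\<And>v. v \<le> n \<Longrightarrow> su' v = su v"
  shows "linked n S pr' su'"
proof (rule linkedI)
  fix u v assume "adjacent n S u v"
  with assms linked_adjacent[OF assms(1) this] adjacent_range[OF linked_range[OF assms(1)] this]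
  show "su' u = v \<and> pr' v = u" by simp
qed (use linked_range[OF assms(1)] in auto)

lemma linked_atLeastAtMost:
  assumes "\<And>v. v \<le> n \<Longrightarrow> su v = Suc v" "\<And>v. v \<le> n \<Longrightarrow> pr (Suc v) = v"
  shows "linked n {1..n} pr su"
proof (rule linkedI)
  fix u v assume *: "adjacent n {1..n} u v"
  then have "u < v" "u \<le> n" "v \<le> Suc n"
    by (auto simp: adjacent_def)
  moreover have "\<not> Suc u < v"
  proof
    assume "Suc u < v"
    then have "Suc u \<in> {1..n}" "u < Suc u"
      using \<open>v \<le> Suc n\<close> by auto
    with * \<open>Suc u < v\<close> show False
      unfolding adjacent_def by blast
  qed
  ultimately have "v = Suc u"
    by auto
  with \<open>u \<le> n\<close> assms show "su u = v \<and> pr v = u"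
    by simp
qed simp

lemma linked_pr:
  assumes "linked n S pr su" "x \<in> S"
  shows "adjacent n S (pr x) x"
proof -
  let ?A = "insert 0 {y \<in> S. y < x}"
  have fin: "finite ?A"
    by (auto intro: finite_subset[of _ "{..<x}"])
  have "0 < x"
    using linked_range[OF assms(1)] assms(2) by force
  define a where "a = Max ?A"
  have "a \<in> ?A"
    unfolding a_def using fin by (rule Max_in) simp
  then have "a < x" "a \<in> insert 0 S"
    using \<open>0 < x\<close> by auto
  moreover have "y \<le> a" if "y \<in> S" "y < x" for y
    unfolding a_def using fin that by (intro Max_ge) auto
  ultimately have "adjacent n S a x"
    using assms(2) unfolding adjacent_def by (meson insertI2 not_le)
  with linked_adjacent[OF assms(1) this] show ?thesis
    by simp
qed

lemma linked_su:
  assumes "linked n S pr su" "x \<in> S"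
  shows "adjacent n S x (su x)"
proof -
  let ?A = "insert (Suc n) {y \<in> S. x < y}"
  have "S \<subseteq> {..n}" "x < Suc n"
    using linked_range[OF assms(1)] assms(2) by force+
  then have fin: "finite ?A"
    using finite_subset[of "{y \<in> S. x < y}" "{..n}"] by auto
  define b where "b = Min ?A"
  have "b \<in> ?A"
    unfolding b_def using fin by (rule Min_in) simp
  then have "x < b" "b \<in> insert (Suc n) S"
    using \<open>x < Suc n\<close> by auto
  moreover have "b \<le> y" if "y \<in> S" "x < y" for y
    unfolding b_def using fin that by (intro Min_le) auto
  ultimately have "adjacent n S x b"
    using assms(2) unfolding adjacent_def by (meson insertI2 not_le)
  with linked_adjacent[OF assms(1) this] show ?thesis
    by simp
qed

text \<open>A pair adjacent after the deletion either straddles \<open>x\<close>, and then it is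
  \<open>pr x\<close> and \<open>su x\<close>, or it was adjacent before and involves neither
  updated pointer.\<close>

lemma linked_delete:
  assumes "linked n S pr su" "x \<in> S"
  shows "linked n (S - {x}) (pr(su x := pr x)) (su(pr x := su x))"
proof -
  have a: "adjacent n S (pr x) x" "adjacent n S x (su x)"
    using linked_pr[OF assms] linked_su[OF assms] .
  then have pr: "pr x < x" "pr x \<in> insert 0 S" "\<And>y. y \<in> S \<Longrightarrow> pr x < y \<Longrightarrow> y < x \<Longrightarrow> False"
    and su: "x < su x" "su x \<in> insert (Suc n) S" "\<And>y. y \<in> S \<Longrightarrow> x < y \<Longrightarrow> y < su x \<Longrightarrow> False"
    unfolding adjacent_def by blast+
  have x: "x \<noteq> 0" "x \<noteq> Suc n"
    using linked_range[OF assms(1)] assms(2) by auto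
  show ?thesis
  proof (rule linkedI)
    fix u v assume uv: "adjacent n (S - {x}) u v"
    then have uv': "u < v" "u \<in> insert 0 (S - {x})" "v \<in> insert (Suc n) (S - {x})"
        "\<And>y. y \<in> S \<Longrightarrow> y \<noteq> x \<Longrightarrow> u < y \<Longrightarrow> y < v \<Longrightarrow> False"
      unfolding adjacent_def by blast+
    then have ne: "u \<noteq> x" "v \<noteq> x"
      using x by auto
    show "(su(pr x := su x)) u = v \<and> (pr(su x := pr x)) v = u"
    proof (cases "u < x \<and> x < v")
      case True
      have "\<not> u < pr x"
        using uv'(4)[of "pr x"] pr(1,2) True by auto
      moreover have "\<not> su x < v"
        using uv'(3) uv'(4)[of "su x"] su(1,2) True linked_range[OF assms(1)] by auto
      moreover have "\<not> pr x < u"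
        using pr(3)[of u] uv'(2) True by auto
      moreover have "\<not> v < su x"
        using su(3)[of v] uv'(3) su(2) True linked_range[OF assms(1)] by auto
      ultimately have "u = pr x" "v = su x" by auto
      then show ?thesis by simp
    next
      case False
      then have "adjacent n S u v"
        using uv' unfolding adjacent_def by blast
      then have "su u = v" "pr v = u"
        using linked_adjacent[OF assms(1)] by blast+
      moreover have "su (pr x) = x" "pr (su x) = x"
        using a linked_adjacent[OF assms(1)] by blast+
      ultimately have "u \<noteq> pr x" "v \<noteq> su x"
        using ne by auto
      with \<open>su u = v\<close> \<open>pr v = u\<close> show ?thesis by simp
    qed
  qed (use linked_range[OF assms(1)] in auto)
qed

section \<open>The matching program\<close>

definition loop_cost :: "com \<Rightarrow> expr \<Rightarrow> expr \<Rightarrow> com \<Rightarrow> nat \<Rightarrow> nat" where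
  "loop_cost C0 a b C k = cost C0 + (k + 1) * (len_expr a + len_expr b + cost C + 2)"

text \<open>The shape of all six phases: an initialisation, then one loop with a loop-free body. The
  potential reads only the variables, and \<open>k\<close> bounds its initial value.\<close>

lemma wp_loop:
  assumes start: "pre w C0 (\<lambda>(\<rho>, \<mu>). I \<rho> \<mu> \<and> V \<rho> \<le> k) (\<rho>\<^sub>0, \<mu>\<^sub>0)"
    and safe: "\<And>\<rho> \<mu>. I \<rho> \<mu> \<Longrightarrow> safe w a (\<rho>, \<mu>) \<and> safe w b (\<rho>, \<mu>)"
    and body: "\<And>\<rho> \<mu>. I \<rho> \<mu> \<Longrightarrow> eval a (\<rho>, \<mu>) < eval b (\<rho>, \<mu>) \<Longrightarrow>
      pre w C (\<lambda>(\<rho>', \<mu>'). I \<rho>' \<mu>' \<and> V \<rho>' < V \<rho>) (\<rho>, \<mu>)"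
    and final: "\<And>\<rho> \<mu>. I \<rho> \<mu> \<Longrightarrow> \<not> eval a (\<rho>, \<mu>) < eval b (\<rho>, \<mu>) \<Longrightarrow> Q \<rho> \<mu>"
  shows "wp w (C0 ;; While_Less a b C) (loop_cost C0 a b C k)
    (\<lambda>(\<rho>, \<mu>). Q \<rho> \<mu>) (\<rho>\<^sub>0, \<mu>\<^sub>0)"
  unfolding loop_cost_def
proof (rule wp_seq[OF pre_wp[OF start]])
  fix s :: state assume "case s of (\<rho>, \<mu>) \<Rightarrow> I \<rho> \<mu> \<and> V \<rho> \<le> k"
  moreover obtain \<rho> \<mu> where s: "s = (\<rho>, \<mu>)" by fastforce
  ultimately have *: "I \<rho> \<mu>" "V \<rho> \<le> k" by auto
  let ?T = "len_expr a + len_expr b + cost C + 2"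
  have "wp w (While_Less a b C) (((\<lambda>(\<rho>, \<mu>). V \<rho>) (\<rho>, \<mu>) + 1) * ?T) (\<lambda>(\<rho>, \<mu>). Q \<rho> \<mu>) (\<rho>, \<mu>)"
  proof (rule wp_while[where I = "\<lambda>(\<rho>, \<mu>). I \<rho> \<mu>"])
    fix s :: state assume I: "case s of (\<rho>, \<mu>) \<Rightarrow> I \<rho> \<mu>"
    obtain \<rho> \<mu> where s: "s = (\<rho>, \<mu>)" by fastforce
    have body': "wp w C (cost C) (\<lambda>(\<rho>', \<mu>'). I \<rho>' \<mu>' \<and> V \<rho>' < V \<rho>) s" if "eval a s < eval b s"
      using I that unfolding s by (intro pre_wp body) auto
    have "wp w C (cost C) (\<lambda>s'. (case s' of (\<rho>, \<mu>) \<Rightarrow> I \<rho> \<mu>) \<and> (case s' of (\<rho>, \<mu>) \<Rightarrow> V \<rho>) <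
        (case s of (\<rho>, \<mu>) \<Rightarrow> V \<rho>)) s" if "eval a s < eval b s"
      by (rule wp_mono[OF body'[OF that] order_refl]) (auto simp: s)
    then show "safe w a s \<and> safe w b s \<and> (if eval a s < eval b s then wp w C (cost C)
        (\<lambda>s'. (case s' of (\<rho>, \<mu>) \<Rightarrow> I \<rho> \<mu>) \<and> (case s' of (\<rho>, \<mu>) \<Rightarrow> V \<rho>) <
        (case s of (\<rho>, \<mu>) \<Rightarrow> V \<rho>)) s else case s of (\<rho>, \<mu>) \<Rightarrow> Q \<rho> \<mu>)"
      using I safe final by (auto simp: s)
  qed (use * in auto)
  moreover have "((\<lambda>(\<rho>, \<mu>). V \<rho>) (\<rho>, \<mu>) + 1) * ?T \<le> (k + 1) * ?T"
    using * by (intro mult_le_mono1) auto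
  ultimately show "wp w (While_Less a b C) ((k + 1) * ?T) (\<lambda>(\<rho>, \<mu>). Q \<rho> \<mu>) s"
    unfolding s by (rule wp_mono)
qed

abbreviation (input) "vM \<equiv> 2 :: nat"
abbreviation (input) "vN \<equiv> 3 :: nat"
abbreviation (input) "vI \<equiv> 4 :: nat"
abbreviation (input) "vQ \<equiv> 5 :: nat"
abbreviation (input) "vX \<equiv> 6 :: nat"
abbreviation (input) "vOK \<equiv> 7 :: nat"
abbreviation (input) "vL \<equiv> 8 :: nat"
abbreviation (input) "vR \<equiv> 9 :: nat"
abbreviation (input) "vB \<equiv> 10 :: nat"

text \<open>The input ends below address \<open>4 * n\<close>.  From there on, a table starts at every multiple of
  \<open>4 * n\<close>: the inverse of the pattern (positions counted from 1, and 0 for absent values), the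
  predecessors and successors in a doubly linked list of values, the neighbours of each
  pattern entry among the preceding ones (below and above), and the failure function.\<close>

abbreviation (input) cell :: "nat \<Rightarrow> expr \<Rightarrow> expr" where
  "cell k e \<equiv> Plus (Times (Num k) (Var vN)) e"

definition init_start :: com where
  "init_start = vM ::= At (Num 0) ;; vN ::= At (Num 1) ;; vI ::= Num 0"

text \<open>Memory is arbitrary at the start, so even zeros have to be written. The loop runs
  through \<open>0, \<dots>, n + 1\<close> because the sentinels need entries too: their position 0
  later reads as a missing neighbour.\<close>

definition init_body :: com where
  "init_body =
     Write (cell 4 (Var vI)) (Num 0) ;;
     Write (cell 8 (Plus (Var vI) (Num 1))) (Var vI) ;;
     Write (cell 12 (Var vI)) (Plus (Var vI) (Num 1)) ;;
     vI ::= Plus (Var vI) (Num 1)"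

definition pos_body :: com where
  "pos_body =
     Write (cell 4 (At (Plus (Var vI) (Num 2)))) (Plus (Var vI) (Num 1)) ;;
     vI ::= Plus (Var vI) (Num 1)"

definition unlink :: com where
  "unlink =
     vL ::= At (cell 8 (Var vX)) ;;
     vR ::= At (cell 12 (Var vX)) ;;
     Write (cell 12 (Var vL)) (Var vR) ;;
     Write (cell 8 (Var vR)) (Var vL)"

text \<open>The list initially contains all of \<open>1, \<dots>, n\<close>.  Values outside the pattern are removed first, then
  the pattern is removed from right to left: just before \<open>p j\<close> is removed, its list
  neighbours are its order neighbours among \<open>p 0, \<dots>, p (j - 1)\<close>.\<close>

definition absent_body :: com where
  "absent_body =
     vX ::= Var vI ;;
     If_Less (At (cell 4 (Var vI))) (Num 1) unlink Skip ;;
     vI ::= Plus (Var vI) (Num 1)"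

definition neighbour_body :: com where
  "neighbour_body =
     vI ::= Minus (Var vI) (Num 1) ;;
     vX ::= At (Plus (Var vI) (Num 2)) ;;
     unlink ;;
     Write (cell 16 (Var vI)) (At (cell 4 (Var vL))) ;;
     Write (cell 20 (Var vI)) (At (cell 4 (Var vR)))"

text \<open>This is the test of \<open>iso_extend\<close>. The guards keep a missing neighbour,
  stored as 0, from being used as an index; the final subtraction of 1 undoes the shift of the
  stored indices.\<close>

definition check :: com where
  "check =
     vX ::= At (Plus (Var vB) (Plus (Var vI) (Var vQ))) ;;
     vOK ::= Num 1 ;;
     vL ::= At (cell 16 (Var vQ)) ;;
     vR ::= At (cell 20 (Var vQ)) ;;
     If_Less (Num 0) (Var vL)
       (If_Less (Var vX) (At (Minus (Plus (Var vB) (Plus (Var vI) (Var vL))) (Num 1))) (vOK ::= Num 0) Skip) Skip ;;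
     If_Less (Num 0) (Var vR)
       (If_Less (At (Minus (Plus (Var vB) (Plus (Var vI) (Var vR))) (Num 1))) (Var vX) (vOK ::= Num 0) Skip) Skip"

definition shift :: com where
  "shift =
     vL ::= At (cell 24 (Var vQ)) ;;
     vI ::= Minus (Plus (Var vI) (Var vQ)) (Var vL) ;;
     vQ ::= Var vL"

text \<open>Both remaining phases keep a window of length \<open>vQ\<close> starting at \<open>vI\<close>, in the pattern itself or in
  the text, that is order-isomorphic to a prefix of the pattern; \<open>vB\<close> is the base address
  of the string in question.\<close>

definition border_start :: com where
  "border_start = Write (cell 24 (Num 1)) (Num 0) ;; vB ::= Num 2 ;; vI ::= Num 1 ;; vQ ::= Num 0"

definition border_body :: com where
  "border_body =
     check ;;
     If_Less (Num 0) (Var vOK)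
       (vQ ::= Plus (Var vQ) (Num 1) ;; Write (cell 24 (Plus (Var vI) (Var vQ))) (Var vQ))
       shift"

text \<open>The output may overwrite the input: the pattern itself is no longer needed, and at most \<open>vI + 1\<close>
  positions have been reported when the text before index \<open>vI + 1\<close> is given up.\<close>

definition search_start :: com where
  "search_start = Write (Num 0) (Num 0) ;; vB ::= Plus (Var vM) (Num 2) ;; vI ::= Num 0 ;; vQ ::= Num 0"

definition search_body :: com where
  "search_body =
     check ;;
     If_Less (Num 0) (Var vOK)
       (vQ ::= Plus (Var vQ) (Num 1) ;;
        If_Less (Var vQ) (Var vM) Skip
          (Write (Num 0) (Plus (At (Num 0)) (Num 1)) ;;
           Write (At (Num 0)) (Plus (Var vI) (Num 1)) ;;
           shift))
       shift"

text \<open>As \<open>1 \<le> n\<close>, the input takes \<open>m + n + 2 \<le> 4 * n\<close> cells,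
  and indices up to \<open>n + 2\<close> stay inside a table of width \<open>4 * n\<close>. The last
  table starts at \<open>24 * n\<close> and ends below \<open>28 * n\<close>, so
  \<open>40 * n\<close> exceeds every address in use and, again by \<open>1 \<le> n\<close>, every
  constant of the program.\<close>

locale matching =
  fixes w n m :: nat and p t :: "nat \<Rightarrow> nat"
  assumes word_size: "40 * n \<le> 2 ^ w"
    and m_pos: "0 < m" and m_le_n: "m \<le> n"
    and inj_p: "inj_on p {..<m}" and range_p: "p ` {..<m} \<subseteq> {1..n}"
    and inj_t: "inj_on t {..<n}"
begin

definition input :: "(nat \<Rightarrow> nat) \<Rightarrow> (nat \<Rightarrow> nat) \<Rightarrow> bool" where
  "input \<rho> \<mu> \<longleftrightarrow> \<rho> vM = m \<and> \<rho> vN = n \<and> (\<forall>j<m. \<mu> (j + 2) = p j) \<and> (\<forall>j<n. \<mu> (m + 2 + j) = t j)"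

definition positions :: "nat \<Rightarrow> (nat \<Rightarrow> nat) \<Rightarrow> bool" where
  "positions k \<mu> \<longleftrightarrow> (\<forall>j<k. \<mu> (4 * n + p j) = Suc j) \<and>
     (\<forall>v\<le>Suc n. v \<notin> p ` {..<k} \<longrightarrow> \<mu> (4 * n + v) = 0)"

definition links :: "nat set \<Rightarrow> (nat \<Rightarrow> nat) \<Rightarrow> bool" where
  "links S \<mu> \<longleftrightarrow> linked n S (\<lambda>v. \<mu> (8 * n + v)) (\<lambda>v. \<mu> (12 * n + v))"

definition neighbours :: "nat \<Rightarrow> (nat \<Rightarrow> nat) \<Rightarrow> bool" where
  "neighbours k \<mu> \<longleftrightarrow> (\<forall>j. k \<le> j \<and> j < m \<longrightarrow> lower p j (\<mu> (16 * n + j)) \<and> upper p j (\<mu> (20 * n + j)))"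

definition borders :: "nat \<Rightarrow> (nat \<Rightarrow> nat) \<Rightarrow> bool" where
  "borders k \<mu> \<longleftrightarrow> (\<forall>e. 0 < e \<and> e \<le> k \<longrightarrow> border p e (\<mu> (24 * n + e)))"

lemma n_pos: "0 < n"
  using m_pos m_le_n by simp

section \<open>Initial tables and bucketing by value\<close>

definition init_inv :: "(nat \<Rightarrow> nat) \<Rightarrow> (nat \<Rightarrow> nat) \<Rightarrow> bool" where
  "init_inv \<rho> \<mu> \<longleftrightarrow> input \<rho> \<mu> \<and> \<rho> vI \<le> n + 2 \<and>
     (\<forall>v<\<rho> vI. \<mu> (4 * n + v) = 0 \<and> \<mu> (8 * n + Suc v) = v \<and> \<mu> (12 * n + v) = Suc v)"

lemma wp_init:
  assumes "\<mu> 0 = m" "\<mu> 1 = n" "\<forall>j<m. \<mu> (j + 2) = p j" "\<forall>j<n. \<mu> (m + 2 + j) = t j"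
  shows "wp w (init_start ;; While_Less (Var vI) (Plus (Var vN) (Num 2)) init_body)
    (loop_cost init_start (Var vI) (Plus (Var vN) (Num 2)) init_body (n + 2))
    (\<lambda>(\<rho>, \<mu>). input \<rho> \<mu> \<and> positions 0 \<mu> \<and> links {1..n} \<mu>) (\<rho>, \<mu>)"
proof (rule wp_loop[where I = init_inv and V = "\<lambda>\<rho>. n + 2 - \<rho> vI"])
  show "pre w init_start (\<lambda>(\<rho>, \<mu>). init_inv \<rho> \<mu> \<and> n + 2 - \<rho> vI \<le> n + 2) (\<rho>, \<mu>)"
    using assms n_pos word_size by (simp add: init_start_def init_inv_def input_def)
next
  fix \<rho> \<mu> assume "init_inv \<rho> \<mu>"
  then show "safe w (Var vI) (\<rho>, \<mu>) \<and> safe w (Plus (Var vN) (Num 2)) (\<rho>, \<mu>)"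
    using n_pos word_size by (simp add: init_inv_def input_def)
next
  fix \<rho> \<mu> assume "init_inv \<rho> \<mu>" "eval (Var vI) (\<rho>, \<mu>) < eval (Plus (Var vN) (Num 2)) (\<rho>, \<mu>)"
  then show "pre w init_body (\<lambda>(\<rho>', \<mu>'). init_inv \<rho>' \<mu>' \<and> n + 2 - \<rho>' vI < n + 2 - \<rho> vI) (\<rho>, \<mu>)"
    using n_pos word_size m_le_n
    by (auto simp: init_body_def init_inv_def input_def less_Suc_eq)
next
  fix \<rho> \<mu> assume "init_inv \<rho> \<mu>" "\<not> eval (Var vI) (\<rho>, \<mu>) < eval (Plus (Var vN) (Num 2)) (\<rho>, \<mu>)"
  then show "input \<rho> \<mu> \<and> positions 0 \<mu> \<and> links {1..n} \<mu>"
    unfolding links_def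
    by (intro conjI linked_atLeastAtMost) (auto simp: init_inv_def input_def positions_def)
qed

definition pos_inv :: "(nat \<Rightarrow> nat) \<Rightarrow> (nat \<Rightarrow> nat) \<Rightarrow> bool" where
  "pos_inv \<rho> \<mu> \<longleftrightarrow> input \<rho> \<mu> \<and> \<rho> vI \<le> m \<and> positions (\<rho> vI) \<mu> \<and> links {1..n} \<mu>"

lemma p_bounds: "j < m \<Longrightarrow> 1 \<le> p j \<and> p j \<le> n"
  using range_p by auto

lemma p_eq_iff: "i < m \<Longrightarrow> j < m \<Longrightarrow> p i = p j \<longleftrightarrow> i = j"
  using inj_p by (auto dest: inj_onD)

lemma links_cong:
  assumes "links S \<mu>" "\<And>v. v \<le> Suc n \<Longrightarrow> \<mu>' (8 * n + v) = \<mu> (8 * n + v)"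
    "\<And>v. v \<le> n \<Longrightarrow> \<mu>' (12 * n + v) = \<mu> (12 * n + v)"
  shows "links S \<mu>'"
  using assms unfolding links_def by (rule linked_cong)

lemma positions_step:
  assumes "positions k \<mu>" "k < m"
  shows "positions (Suc k) (\<mu>(4 * n + p k := Suc k))"
  using assms p_eq_iff[of _ k] by (auto simp: positions_def lessThan_Suc less_Suc_eq)

lemma input_cong:
  assumes "input \<rho> \<mu>" "\<rho>' vM = \<rho> vM" "\<rho>' vN = \<rho> vN" "\<And>a. a < 4 * n \<Longrightarrow> \<mu>' a = \<mu> a"
  shows "input \<rho>' \<mu>'"
  using assms m_pos m_le_n by (simp add: input_def)

lemma input_regs: "input \<rho> \<mu> \<Longrightarrow> \<rho> vM = m \<and> \<rho> vN = n"
  by (simp add: input_def)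

lemma wp_pos:
  assumes "input \<rho> \<mu>" "positions 0 \<mu>" "links {1..n} \<mu>"
  shows "wp w (vI ::= Num 0 ;; While_Less (Var vI) (Var vM) pos_body)
    (loop_cost (vI ::= Num 0) (Var vI) (Var vM) pos_body m)
    (\<lambda>(\<rho>, \<mu>). input \<rho> \<mu> \<and> positions m \<mu> \<and> links {1..n} \<mu>) (\<rho>, \<mu>)"
proof (rule wp_loop[where I = pos_inv and V = "\<lambda>\<rho>. m - \<rho> vI"])
  show "pre w (vI ::= Num 0) (\<lambda>(\<rho>, \<mu>). pos_inv \<rho> \<mu> \<and> m - \<rho> vI \<le> m) (\<rho>, \<mu>)"
    using assms by (simp add: pos_inv_def input_def)
next
  fix \<rho> \<mu> assume inv: "pos_inv \<rho> \<mu>" "eval (Var vI) (\<rho>, \<mu>) < eval (Var vM) (\<rho>, \<mu>)"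
  let ?\<mu> = "\<mu>(4 * n + p (\<rho> vI) := Suc (\<rho> vI))"
  have inp: "input \<rho> \<mu>" and pos: "positions (\<rho> vI) \<mu>" and links: "links {1..n} \<mu>"
    using inv(1) by (simp_all add: pos_inv_def)
  have i: "\<rho> vI < m"
    using inv(2) input_regs[OF inp] by simp
  have reg: "\<rho> vM = m" "\<rho> vN = n" "\<mu> (\<rho> vI + 2) = p (\<rho> vI)"
    using inp i by (simp_all add: input_def)
  have "links {1..n} ?\<mu>"
    using links by (rule links_cong) (use p_bounds[OF i] n_pos in auto)
  moreover have "positions (Suc (\<rho> vI)) ?\<mu>"
    using pos i by (rule positions_step)
  moreover have "input (\<rho>(vI := Suc (\<rho> vI))) ?\<mu>"
    using inp by (rule input_cong) auto
  ultimately show "pre w pos_body (\<lambda>(\<rho>', \<mu>'). pos_inv \<rho>' \<mu>' \<and> m - \<rho>' vI < m - \<rho> vI) (\<rho>, \<mu>)"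
    using reg i n_pos word_size m_le_n p_bounds[OF i]
    by (simp add: pos_body_def pos_inv_def)
next
  fix \<rho> \<mu> assume inv: "pos_inv \<rho> \<mu>" "\<not> eval (Var vI) (\<rho>, \<mu>) < eval (Var vM) (\<rho>, \<mu>)"
  then have "\<rho> vI = m"
    using input_regs[of \<rho> \<mu>] by (auto simp: pos_inv_def)
  with inv(1) show "input \<rho> \<mu> \<and> positions m \<mu> \<and> links {1..n} \<mu>"
    by (simp add: pos_inv_def)
qed simp

section \<open>Deletion of the absent values\<close>

definition absent_inv :: "(nat \<Rightarrow> nat) \<Rightarrow> (nat \<Rightarrow> nat) \<Rightarrow> bool" where
  "absent_inv \<rho> \<mu> \<longleftrightarrow> input \<rho> \<mu> \<and> 1 \<le> \<rho> vI \<and> \<rho> vI \<le> Suc n \<and> positions m \<mu> \<and>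
     links {v \<in> {1..n}. v < \<rho> vI \<longrightarrow> v \<in> p ` {..<m}} \<mu>"

lemma positions_cong:
  assumes "positions k \<mu>" "k \<le> m" "\<And>v. v \<le> Suc n \<Longrightarrow> \<mu>' (4 * n + v) = \<mu> (4 * n + v)"
  shows "positions k \<mu>'"
proof -
  have "\<mu>' (4 * n + p j) = \<mu> (4 * n + p j)" if "j < k" for j
    using p_bounds[of j] assms(2) that by (intro assms(3)) simp
  with assms(1,3) show ?thesis
    by (simp add: positions_def)
qed

lemma links_delete:
  assumes "links S \<mu>" "x \<in> S"
  defines "l \<equiv> \<mu> (8 * n + x)" and "r \<equiv> \<mu> (12 * n + x)"
  shows "links (S - {x}) (\<mu>(12 * n + l := r, 8 * n + r := l))"
    and "adjacent n S l x" "adjacent n S x r" "l \<le> n" "r \<le> Suc n"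
proof -
  have S: "S \<subseteq> {1..n}"
    using assms(1) unfolding links_def by (rule linked_range)
  show adj: "adjacent n S l x" "adjacent n S x r"
    using linked_pr[OF assms(1)[unfolded links_def] assms(2)] linked_su[OF assms(1)[unfolded links_def] assms(2)]
    by (simp_all add: l_def r_def)
  then show le: "l \<le> n" "r \<le> Suc n"
    using adjacent_range[OF S] by blast+
  have "linked n (S - {x}) ((\<lambda>v. \<mu> (8 * n + v))(r := l)) ((\<lambda>v. \<mu> (12 * n + v))(l := r))"
    using linked_delete[OF assms(1)[unfolded links_def] assms(2)] by (simp add: l_def r_def)
  then show "links (S - {x}) (\<mu>(12 * n + l := r, 8 * n + r := l))"
    unfolding links_def by (rule linked_cong) (use le n_pos in auto)
qed

text \<open>The continuation \<open>Q\<close> is arbitrary so that the rule serves both deletion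
  phases; \<open>post\<close> hands over the neighbours that \<open>x\<close> has at the moment of
  its deletion.\<close>

lemma pre_unlink:
  assumes "links S \<mu>" "x \<in> S" "\<rho> vN = n" "\<rho> vX = x"
    and post: "\<And>l r. l = \<mu> (8 * n + x) \<Longrightarrow> r = \<mu> (12 * n + x) \<Longrightarrow> adjacent n S l x \<Longrightarrow> adjacent n S x r \<Longrightarrow>
      l \<le> n \<Longrightarrow> r \<le> Suc n \<Longrightarrow> links (S - {x}) (\<mu>(12 * n + l := r, 8 * n + r := l)) \<Longrightarrow>
      Q (\<rho>(vL := l, vR := r), \<mu>(12 * n + l := r, 8 * n + r := l))"
  shows "pre w unlink Q (\<rho>, \<mu>)"
proof -
  have "x \<le> n"
    using assms(1,2) linked_range unfolding links_def by fastforce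
  moreover note d = links_delete[OF assms(1,2)] 
  moreover note post[OF refl refl d(2,3,4,5,1)]
  ultimately show ?thesis
    using n_pos word_size assms(3,4) by (simp add: unlink_def)
qed

lemma wp_absent:
  assumes "input \<rho> \<mu>" "positions m \<mu>" "links {1..n} \<mu>"
  shows "wp w (vI ::= Num 1 ;; While_Less (Var vI) (Plus (Var vN) (Num 1)) absent_body)
    (loop_cost (vI ::= Num 1) (Var vI) (Plus (Var vN) (Num 1)) absent_body n)
    (\<lambda>(\<rho>, \<mu>). input \<rho> \<mu> \<and> positions m \<mu> \<and> links (p ` {..<m}) \<mu>) (\<rho>, \<mu>)"
proof (rule wp_loop[where I = absent_inv and V = "\<lambda>\<rho>. Suc n - \<rho> vI"])
  have "{v \<in> {1..n}. v < 1 \<longrightarrow> v \<in> p ` {..<m}} = {1..n}" by auto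
  then show "pre w (vI ::= Num 1) (\<lambda>(\<rho>, \<mu>). absent_inv \<rho> \<mu> \<and> Suc n - \<rho> vI \<le> n) (\<rho>, \<mu>)"
    using assms n_pos word_size by (simp add: absent_inv_def input_def)
next
  fix \<rho> \<mu> assume inv: "absent_inv \<rho> \<mu>"
  then show "safe w (Var vI) (\<rho>, \<mu>) \<and> safe w (Plus (Var vN) (Num 1)) (\<rho>, \<mu>)"
    using n_pos word_size by (simp add: absent_inv_def input_def)
  assume "eval (Var vI) (\<rho>, \<mu>) < eval (Plus (Var vN) (Num 1)) (\<rho>, \<mu>)"
  then have i: "1 \<le> \<rho> vI" "\<rho> vI \<le> n" and N: "\<rho> vN = n"
    using inv by (simp_all add: absent_inv_def input_def)
  define S where "S k = {v \<in> {1..n}. v < k \<longrightarrow> v \<in> p ` {..<m}}" for k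
  have links: "links (S (\<rho> vI)) \<mu>" and pos: "positions m \<mu>" and inp: "input \<rho> \<mu>"
    using inv by (simp_all add: absent_inv_def S_def)
  have present: "\<mu> (4 * n + \<rho> vI) < 1 \<longleftrightarrow> \<rho> vI \<notin> p ` {..<m}"
    using pos i by (auto simp: positions_def)
  have inv': "absent_inv \<rho>' \<mu>' \<longleftrightarrow> input \<rho>' \<mu>' \<and> positions m \<mu>' \<and> links (S (Suc (\<rho> vI))) \<mu>'"
    if "\<rho>' vI = Suc (\<rho> vI)" for \<rho>' \<mu>'
    using that i by (auto simp: absent_inv_def S_def)
  show "pre w absent_body (\<lambda>(\<rho>', \<mu>'). absent_inv \<rho>' \<mu>' \<and> Suc n - \<rho>' vI < Suc n - \<rho> vI) (\<rho>, \<mu>)"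
  proof (cases "\<rho> vI \<in> p ` {..<m}")
    case True
    have "S (Suc (\<rho> vI)) = S (\<rho> vI)"
      using True by (auto simp: S_def less_Suc_eq)
    moreover have "input (\<rho>(vX := \<rho> vI, vI := Suc (\<rho> vI))) \<mu>"
      using inp by (rule input_cong) auto
    ultimately show ?thesis
      using True present links pos i N n_pos word_size by (simp add: absent_body_def inv')
  next
    case False
    have S: "S (Suc (\<rho> vI)) = S (\<rho> vI) - {\<rho> vI}" "\<rho> vI \<in> S (\<rho> vI)"
      using False i by (auto simp: S_def less_Suc_eq)
    let ?Q = "pre w (vI ::= Plus (Var vI) (Num 1)) (\<lambda>(\<rho>', \<mu>'). absent_inv \<rho>' \<mu>' \<and> Suc n - \<rho>' vI < Suc n - \<rho> vI)"
    have "pre w unlink ?Q (\<rho>(vX := \<rho> vI), \<mu>)"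
    proof (rule pre_unlink[OF links S(2)])
      fix l r
      let ?\<mu> = "\<mu>(12 * n + l := r, 8 * n + r := l)"
      assume lr: "l \<le> n" "r \<le> Suc n" "links (S (\<rho> vI) - {\<rho> vI}) ?\<mu>"
      have "positions m ?\<mu>"
        using pos by (rule positions_cong) (use lr n_pos in auto)
      moreover have "input (\<rho>(vX := \<rho> vI, vL := l, vR := r, vI := Suc (\<rho> vI))) ?\<mu>"
        using inp by (rule input_cong) (use lr n_pos in auto)
      ultimately show "?Q (\<rho>(vX := \<rho> vI, vL := l, vR := r), ?\<mu>)"
        using i n_pos word_size lr(3) by (auto simp: inv' S(1))
    qed (use N in auto)
    with False show ?thesis
      using present i N n_pos word_size by (simp add: absent_body_def)
  qed
next
  fix \<rho> \<mu> assume inv: "absent_inv \<rho> \<mu>" "\<not> eval (Var vI) (\<rho>, \<mu>) < eval (Plus (Var vN) (Num 1)) (\<rho>, \<mu>)"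
  then have "\<rho> vI = Suc n"
    by (auto simp: absent_inv_def input_def)
  then have "{v \<in> {1..n}. v < \<rho> vI \<longrightarrow> v \<in> p ` {..<m}} = p ` {..<m}"
    using range_p by auto
  with inv show "input \<rho> \<mu> \<and> positions m \<mu> \<and> links (p ` {..<m}) \<mu>"
    by (simp add: absent_inv_def)
qed

section \<open>Order neighbours from list neighbours\<close>

lemma positions_eq:
  assumes "positions m \<mu>" "v \<le> Suc n" "v \<in> insert 0 (insert (Suc n) (p ` {..j}))" "j < m"
  shows "(\<mu> (4 * n + v) = 0 \<and> v \<notin> p ` {..j}) \<or> (\<exists>a\<le>j. v = p a \<and> \<mu> (4 * n + v) = Suc a)"
proof (cases "v \<in> p ` {..j}")
  case True
  then obtain a where "a \<le> j" "v = p a" by auto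
  with assms(1,4) show ?thesis
    by (auto simp: positions_def)
next
  case False
  \<comment> \<open>The position table covers the whole pattern, but list members are among its
    first \<open>Suc j\<close> entries. Only the sentinels remain here; they do not occur in the
    pattern and therefore read 0.\<close>
  then have "v = 0 \<or> v = Suc n"
    using assms(3) by auto
  then have "v \<notin> p ` {..<m}"
    using range_p by auto
  with False assms(1,2) show ?thesis
    by (auto simp: positions_def)
qed

text \<open>The list holds just the entries up to index \<open>j\<close>, and none lies strictly
  between \<open>l\<close> and \<open>p j\<close>. Hence \<open>l\<close> is the largest earlier
  entry below \<open>p j\<close>, or the sentinel 0 if there is none. The position table turns this
  value into an index plus 1, or into 0.\<close>

lemma lower_adjacent:
  assumes "positions m \<mu>" "j < m" "adjacent n (p ` {..j}) l (p j)"
  shows "lower p j (\<mu> (4 * n + l))"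
proof -
  have adj: "l < p j" "l \<in> insert 0 (p ` {..j})" "\<And>a. a \<le> j \<Longrightarrow> \<not> (l < p a \<and> p a < p j)"
    using assms(3) by (auto simp: adjacent_def)
  have "l \<le> Suc n"
    using adj(1) p_bounds[OF assms(2)] by simp
  moreover have "l \<in> insert 0 (insert (Suc n) (p ` {..j}))"
    using adj(2) by auto
  ultimately have "(\<mu> (4 * n + l) = 0 \<and> l \<notin> p ` {..j}) \<or> (\<exists>a\<le>j. l = p a \<and> \<mu> (4 * n + l) = Suc a)"
    using assms(2) by (rule positions_eq[OF assms(1)])
  then consider "\<mu> (4 * n + l) = 0" "l \<notin> p ` {..j}" | a where "a \<le> j" "l = p a" "\<mu> (4 * n + l) = Suc a"
    by metis
  then show ?thesis
  proof cases
    case 1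
    then have "l = 0"
      using adj(2) by simp
    have "\<not> p a < p j" if "a < j" for a
      using adj(3)[of a] that p_bounds[of a] assms(2) \<open>l = 0\<close> by auto
    with 1 show ?thesis
      by (simp add: lower_def)
  next
    case 2
    then have "a < j"
      using adj(1) by (cases "a = j") auto
    moreover have "p b \<le> p a" if "b < j" "p b < p j" for b
      using adj(3)[of b] that 2(2) by auto
    ultimately show ?thesis
      using 2 adj(1) by (simp add: lower_def)
  qed
qed

lemma upper_adjacent:
  assumes "positions m \<mu>" "j < m" "adjacent n (p ` {..j}) (p j) r"
  shows "upper p j (\<mu> (4 * n + r))"
proof -
  have adj: "p j < r" "r \<in> insert (Suc n) (p ` {..j})" "\<And>a. a \<le> j \<Longrightarrow> \<not> (p j < p a \<and> p a < r)"
    using assms(3) by (auto simp: adjacent_def)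
  have "r \<le> Suc n"
    using adj(2) p_bounds assms(2) by (auto intro: le_SucI)
  moreover have "r \<in> insert 0 (insert (Suc n) (p ` {..j}))"
    using adj(2) by auto
  ultimately have "(\<mu> (4 * n + r) = 0 \<and> r \<notin> p ` {..j}) \<or> (\<exists>a\<le>j. r = p a \<and> \<mu> (4 * n + r) = Suc a)"
    using assms(2) by (rule positions_eq[OF assms(1)])
  then consider "\<mu> (4 * n + r) = 0" "r \<notin> p ` {..j}" | a where "a \<le> j" "r = p a" "\<mu> (4 * n + r) = Suc a"
    by metis
  then show ?thesis
  proof cases
    case 1
    then have "r = Suc n"
      using adj(2) by simp
    have "\<not> p j < p a" if "a < j" for a
      using adj(3)[of a] that p_bounds[of a] assms(2) \<open>r = Suc n\<close> by auto
    with 1 show ?thesis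
      by (simp add: upper_def)
  next
    case 2
    then have "a < j"
      using adj(1) by (cases "a = j") auto
    moreover have "p a \<le> p b" if "b < j" "p j < p b" for b
      using adj(3)[of b] that 2(2) by auto
    ultimately show ?thesis
      using 2 adj(1) by (simp add: upper_def)
  qed
qed

definition neighbour_inv :: "(nat \<Rightarrow> nat) \<Rightarrow> (nat \<Rightarrow> nat) \<Rightarrow> bool" where
  "neighbour_inv \<rho> \<mu> \<longleftrightarrow> input \<rho> \<mu> \<and> \<rho> vI \<le> m \<and> positions m \<mu> \<and> links (p ` {..<\<rho> vI}) \<mu> \<and>
     neighbours (\<rho> vI) \<mu>"

lemma neighbours_step:
  assumes "neighbours (Suc j) \<mu>" "j < m" "lower p j l" "upper p j r"
    "\<And>a. 16 * n \<le> a \<Longrightarrow> \<mu>' a = \<mu> a"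
  shows "neighbours j (\<mu>'(16 * n + j := l, 20 * n + j := r))"
  unfolding neighbours_def
proof (intro allI impI)
  fix k assume k: "j \<le> k \<and> k < m"
  let ?\<mu> = "\<mu>'(16 * n + j := l, 20 * n + j := r)"
  show "lower p k (?\<mu> (16 * n + k)) \<and> upper p k (?\<mu> (20 * n + k))"
  proof (cases "k = j")
    case True
    then show ?thesis using assms(3,4) k m_le_n by simp
  next
    case False
    then have "?\<mu> (16 * n + k) = \<mu> (16 * n + k)" "?\<mu> (20 * n + k) = \<mu> (20 * n + k)"
      using k m_le_n assms(5) by simp_all
    with False k assms(1) show ?thesis
      by (simp add: neighbours_def)
  qed
qed

lemma wp_neighbour:
  assumes "input \<rho> \<mu>" "positions m \<mu>" "links (p ` {..<m}) \<mu>"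
  shows "wp w (vI ::= Var vM ;; While_Less (Num 0) (Var vI) neighbour_body)
    (loop_cost (vI ::= Var vM) (Num 0) (Var vI) neighbour_body m)
    (\<lambda>(\<rho>, \<mu>). input \<rho> \<mu> \<and> neighbours 0 \<mu>) (\<rho>, \<mu>)"
proof (rule wp_loop[where I = neighbour_inv and V = "\<lambda>\<rho>. \<rho> vI"])
  have "input (\<rho>(vI := m)) \<mu>"
    using assms(1) by (rule input_cong) auto
  then show "pre w (vI ::= Var vM) (\<lambda>(\<rho>, \<mu>). neighbour_inv \<rho> \<mu> \<and> \<rho> vI \<le> m) (\<rho>, \<mu>)"
    using assms input_regs[OF assms(1)] by (auto simp: neighbour_inv_def neighbours_def)
next
  fix \<rho> \<mu> assume inv: "neighbour_inv \<rho> \<mu>" "eval (Num 0) (\<rho>, \<mu>) < eval (Var vI) (\<rho>, \<mu>)"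
  define j where "j = \<rho> vI - 1"
  have i: "\<rho> vI = Suc j" and j: "j < m"
    using inv by (auto simp: j_def neighbour_inv_def)
  have inp: "input \<rho> \<mu>" and pos: "positions m \<mu>" and links: "links (p ` {..j}) \<mu>"
    and nb: "neighbours (Suc j) \<mu>"
    using inv(1) i by (simp_all add: neighbour_inv_def lessThan_Suc_atMost)
  have reg: "\<rho> vM = m" "\<rho> vN = n" "\<mu> (j + 2) = p j"
    using inp j by (simp_all add: input_def)
  have del: "p ` {..j} - {p j} = p ` {..<j}"
    using p_eq_iff j by (auto simp: lessThan_Suc_atMost[symmetric] lessThan_Suc)
  let ?\<rho> = "\<rho>(vI := j, vX := p j)"
  let ?Q = "\<lambda>(\<rho>', \<mu>'). neighbour_inv \<rho>' \<mu>' \<and> \<rho>' vI < \<rho> vI"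
  let ?W = "Write (cell 16 (Var vI)) (At (cell 4 (Var vL))) ;; Write (cell 20 (Var vI)) (At (cell 4 (Var vR)))"
  have "pre w unlink (pre w ?W ?Q) (?\<rho>, \<mu>)"
  proof (rule pre_unlink[OF links, where x = "p j"])
    fix l r
    let ?\<mu> = "\<mu>(12 * n + l := r, 8 * n + r := l)"
    let ?\<nu> = "?\<mu>(16 * n + j := \<mu> (4 * n + l), 20 * n + j := \<mu> (4 * n + r))"
    assume adj: "adjacent n (p ` {..j}) l (p j)" "adjacent n (p ` {..j}) (p j) r"
      and le: "l \<le> n" "r \<le> Suc n" and links': "links (p ` {..j} - {p j}) ?\<mu>"
    have "input (?\<rho>(vL := l, vR := r)) ?\<nu>"
      using inp by (rule input_cong) (use le n_pos in auto)
    moreover have "positions m ?\<nu>"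
      using pos by (rule positions_cong) (use le n_pos in auto)
    moreover have "links (p ` {..<j}) ?\<nu>"
      using links'[unfolded del] by (rule links_cong) (use le n_pos in auto)
    moreover have "neighbours j ?\<nu>"
      using nb j lower_adjacent[OF pos j adj(1)] upper_adjacent[OF pos j adj(2)]
      by (rule neighbours_step) (use le n_pos in auto)
    ultimately show "pre w ?W ?Q (?\<rho>(vL := l, vR := r), ?\<mu>)"
      using reg i j le n_pos m_le_n word_size by (simp add: neighbour_inv_def)
  qed (use reg in auto)
  then show "pre w neighbour_body ?Q (\<rho>, \<mu>)"
    using reg i j n_pos m_le_n word_size by (simp add: neighbour_body_def)
next
  fix \<rho> \<mu> assume "neighbour_inv \<rho> \<mu>" "\<not> eval (Num 0) (\<rho>, \<mu>) < eval (Var vI) (\<rho>, \<mu>)"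
  then show "input \<rho> \<mu> \<and> neighbours 0 \<mu>"
    by (simp add: neighbour_inv_def)
qed simp

text \<open>\<open>b\<close> is the base address of the string \<open>s\<close>, which will be the
  pattern or the text. \<open>post\<close> exposes only which variables may have changed and the
  verdict in \<open>vOK\<close>, so that callers never see the code of \<open>check\<close>.\<close>

lemma pre_check:
  assumes reg: "\<rho> vN = n" "\<rho> vI = i" "\<rho> vQ = q" "\<rho> vB = b"
    and bounds: "q < m" "b + (i + q) < 4 * n"
    and nb: "neighbours 0 \<mu>"
    and s: "\<And>j. i \<le> j \<Longrightarrow> j \<le> i + q \<Longrightarrow> \<mu> (b + j) = s j" "inj_on s {i..i + q}"
    and iso: "isomorphic_at p s i q"
    and post: "\<And>\<rho>'. (\<And>x. x \<notin> {vX, vOK, vL, vR} \<Longrightarrow> \<rho>' x = \<rho> x) \<Longrightarrow>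
      \<rho>' vOK = (if isomorphic_at p s i (Suc q) then 1 else 0) \<Longrightarrow> Q (\<rho>', \<mu>)"
  shows "pre w check Q (\<rho>, \<mu>)"
proof -
  define l where "l = \<mu> (16 * n + q)"
  define r where "r = \<mu> (20 * n + q)"
  have lr: "lower p q l" "upper p q r"
    using nb bounds by (simp_all add: neighbours_def l_def r_def)
  then have le: "l \<le> q" "r \<le> q"
    by (simp_all add: lower_def upper_def)
  have inj: "inj_on p {..q}"
    using inj_p by (rule inj_on_subset) (use bounds in auto)
  have ext: "isomorphic_at p s i (Suc q) \<longleftrightarrow>
    \<not> (0 < l \<and> s (i + q) < s (i + l - 1)) \<and> \<not> (0 < r \<and> s (i + r - 1) < s (i + q))"
    by (rule iso_extend[OF iso lr inj s(2)])
  have mem: "\<mu> (b + (i + q)) = s (i + q)" "0 < l \<Longrightarrow> \<mu> (b + (i + l) - 1) = s (i + l - 1)"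
    "0 < r \<Longrightarrow> \<mu> (b + (i + r) - 1) = s (i + r - 1)"
    using s(1)[of "i + q"] s(1)[of "i + l - 1"] s(1)[of "i + r - 1"] le by simp_all
  have yes: "Q (\<rho>(vX := s (i + q), vOK := 1, vL := l, vR := r), \<mu>)" if "isomorphic_at p s i (Suc q)"
    using that by (intro post) auto
  have no: "Q (\<rho>(vX := s (i + q), vL := l, vR := r, vOK := 0), \<mu>)" if "\<not> isomorphic_at p s i (Suc q)"
    using that by (intro post) auto
  show ?thesis
    using yes no mem le bounds n_pos m_le_n word_size unfolding ext
    by (cases "l = 0"; cases "r = 0"; simp add: check_def reg l_def[symmetric] r_def[symmetric])
qed

lemma pre_shift:
  assumes "\<rho> vN = n" "\<rho> vI = i" "\<rho> vQ = q" "\<mu> (24 * n + q) = k" "q \<le> m" "i \<le> n" "k \<le> q"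
    and "Q (\<rho>(vL := k, vI := i + q - k, vQ := k), \<mu>)"
  shows "pre w shift Q (\<rho>, \<mu>)"
  using assms n_pos m_le_n word_size by (simp add: shift_def)

section \<open>The failure function\<close>

lemma iso_1: "isomorphic_at p s i (Suc 0)"
  by (simp add: isomorphic_at_def)

lemma neighbours_cong:
  assumes "neighbours k \<mu>" "\<And>a. 16 * n \<le> a \<Longrightarrow> a < 24 * n \<Longrightarrow> \<mu>' a = \<mu> a"
  shows "neighbours k \<mu>'"
  using assms m_le_n by (simp add: neighbours_def)

text \<open>The last clause excludes earlier starts for windows that reach one entry beyond the
  current end. This is the maximality that \<open>border\<close> demands for length
  \<open>vI + vQ + 1\<close> once the test succeeds. A shift looks up only length \<open>vQ\<close>,
  whose border is already known.\<close>

definition border_inv :: "(nat \<Rightarrow> nat) \<Rightarrow> (nat \<Rightarrow> nat) \<Rightarrow> bool" where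
  "border_inv \<rho> \<mu> \<longleftrightarrow> input \<rho> \<mu> \<and> \<rho> vB = 2 \<and> neighbours 0 \<mu> \<and> borders (\<rho> vI + \<rho> vQ) \<mu> \<and>
     1 \<le> \<rho> vI \<and> \<rho> vI + \<rho> vQ \<le> m \<and> isomorphic_at p p (\<rho> vI) (\<rho> vQ) \<and>
     (\<forall>d. 0 < d \<and> d < \<rho> vI \<longrightarrow> \<not> isomorphic_at p p d (Suc (\<rho> vI + \<rho> vQ) - d))"

lemma wp_border:
  assumes "input \<rho> \<mu>" "neighbours 0 \<mu>"
  shows "wp w (border_start ;; While_Less (Plus (Var vI) (Var vQ)) (Var vM) border_body)
    (loop_cost border_start (Plus (Var vI) (Var vQ)) (Var vM) border_body (m + m))
    (\<lambda>(\<rho>, \<mu>). input \<rho> \<mu> \<and> neighbours 0 \<mu> \<and> borders m \<mu>) (\<rho>, \<mu>)"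
\<comment> \<open>A successful test raises \<open>vI + vQ\<close>, and a shift raises
  \<open>vI\<close> while keeping the sum, so this potential drops in every round. Being at most
  \<open>m + m\<close>, it gives linear time.\<close>
proof (rule wp_loop[where I = border_inv and V = "\<lambda>\<rho>. (m - (\<rho> vI + \<rho> vQ)) + (m - \<rho> vI)"])
  let ?\<mu> = "\<mu>(24 * n + 1 := 0)"
  \<comment> \<open>A single entry has only the empty proper suffix, so its border 0 is entered by
    hand. The window starts at index 1, because start 0 would match the pattern with itself.\<close>
  have "borders 1 ?\<mu>"
    by (auto simp: borders_def border_def less_Suc_eq_le le_Suc_eq)
  moreover have "input (\<rho>(vB := 2, vI := 1, vQ := 0)) ?\<mu>"
    using assms(1) by (rule input_cong) auto
  moreover have "neighbours 0 ?\<mu>"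
    using assms(2) by (rule neighbours_cong) auto
  ultimately show "pre w border_start (\<lambda>(\<rho>, \<mu>). border_inv \<rho> \<mu> \<and>
      (m - (\<rho> vI + \<rho> vQ)) + (m - \<rho> vI) \<le> m + m) (\<rho>, \<mu>)"
    using input_regs[OF assms(1)] n_pos m_pos word_size
    by (simp add: border_start_def border_inv_def)
next
  fix \<rho> \<mu> assume inv: "border_inv \<rho> \<mu>"
  define i q where "i = \<rho> vI" and "q = \<rho> vQ"
  have inp: "input \<rho> \<mu>" and B: "\<rho> vB = 2" and nb: "neighbours 0 \<mu>" and bd: "borders (i + q) \<mu>"
    and i: "1 \<le> i" "i + q \<le> m" and iso: "isomorphic_at p p i q"
    and skip: "\<And>d. 0 < d \<Longrightarrow> d < i \<Longrightarrow> \<not> isomorphic_at p p d (Suc (i + q) - d)"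
    using inv by (simp_all add: border_inv_def i_def q_def)
  have reg: "\<rho> vM = m" "\<rho> vN = n" "\<rho> vI = i" "\<rho> vQ = q"
    using inp by (simp_all add: input_def i_def q_def)
  show "safe w (Plus (Var vI) (Var vQ)) (\<rho>, \<mu>) \<and> safe w (Var vM) (\<rho>, \<mu>)"
    using i n_pos m_le_n word_size by (simp add: reg)
  assume "eval (Plus (Var vI) (Var vQ)) (\<rho>, \<mu>) < eval (Var vM) (\<rho>, \<mu>)"
  then have less: "i + q < m"
    by (simp add: reg)
  let ?V = "\<lambda>\<rho>. (m - (\<rho> vI + \<rho> vQ)) + (m - \<rho> vI)"
  let ?Q = "\<lambda>(\<rho>', \<mu>'). border_inv \<rho>' \<mu>' \<and> ?V \<rho>' < ?V \<rho>"
  have "pre w check (pre w (If_Less (Num 0) (Var vOK)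
     (vQ ::= Plus (Var vQ) (Num 1) ;; Write (cell 24 (Plus (Var vI) (Var vQ))) (Var vQ)) shift) ?Q) (\<rho>, \<mu>)"
  proof (rule pre_check[where s = p, OF reg(2-4) B _ _ nb _ _ iso])
    show "inj_on p {i..i + q}"
      using inj_p by (rule inj_on_subset) (use less in auto)
    show "\<mu> (2 + j) = p j" if "i \<le> j" "j \<le> i + q" for j
      using inp that less by (simp add: input_def add.commute)
  next
    fix \<rho>' assume same: "\<And>x. x \<notin> {vX, vOK, vL, vR} \<Longrightarrow> \<rho>' x = \<rho> x"
      and ok: "\<rho>' vOK = (if isomorphic_at p p i (Suc q) then 1 else 0)"
    have reg': "\<rho>' vM = m" "\<rho>' vN = n" "\<rho>' vI = i" "\<rho>' vQ = q" "\<rho>' vB = 2"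
      using same reg B by auto
    show "pre w (If_Less (Num 0) (Var vOK)
       (vQ ::= Plus (Var vQ) (Num 1) ;; Write (cell 24 (Plus (Var vI) (Var vQ))) (Var vQ)) shift) ?Q (\<rho>', \<mu>)"
    proof (cases "isomorphic_at p p i (Suc q)")
      case True
      let ?\<mu> = "\<mu>(24 * n + Suc (i + q) := Suc q)"
      have "border p (Suc (i + q)) (Suc q)"
        using True skip i by (simp add: border_def)
      then have "borders (Suc (i + q)) ?\<mu>"
        using bd by (auto simp: borders_def le_Suc_eq)
      moreover have "input (\<rho>'(vQ := Suc q)) ?\<mu>"
        using inp by (rule input_cong) (use reg reg' in auto)
      moreover have "neighbours 0 ?\<mu>"
        using nb by (rule neighbours_cong) auto
      moreover have "\<not> isomorphic_at p p d (Suc (Suc (i + q)) - d)" if "0 < d" "d < i" for d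
        using skip[OF that] iso_mono[of p p d "Suc (Suc (i + q)) - d" "Suc (i + q) - d"] by (auto simp: diff_le_mono)
      ultimately have "border_inv (\<rho>'(vQ := Suc q)) ?\<mu>"
        using True reg' i less by (simp add: border_inv_def)
      with True show ?thesis
        using ok reg reg' i less n_pos m_le_n word_size by simp
    next
      case False
      \<comment> \<open>A single entry always matches, so the test cannot fail at
        \<open>q = 0\<close>, a length that has no border to shift by.\<close>
      then have "0 < q"
        using iso_1 by (cases q) auto
      define k where "k = \<mu> (24 * n + q)"
      have k: "border p q k"
        using bd \<open>0 < q\<close> by (simp add: borders_def k_def)
      then have "k < q"
        by (simp add: border_def)
      have "pre w shift ?Q (\<rho>', \<mu>)"
      proof (rule pre_shift[where i = i and q = q and k = k])
        have "input (\<rho>'(vL := k, vI := i + q - k, vQ := k)) \<mu>"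
          using inp by (rule input_cong) (use reg reg' in auto)
        moreover have "isomorphic_at p p (i + q - k) k"
          using iso k by (rule iso_shift)
        \<comment> \<open>Starts before \<open>i\<close> are excluded by the invariant,
          \<open>i\<close> itself by the failed test, and starts after \<open>i\<close> by the
          maximality of the border.\<close>
        moreover have "\<not> isomorphic_at p p d (Suc (i + q) - d)" if d: "0 < d" "d < i + q - k" for d
        proof (cases d i rule: linorder_cases)
          case less
          with skip d show ?thesis by blast
        next
          case equal
          with False show ?thesis by simp
        next
          case greater
          with not_iso_between[OF iso k _ d(2)] show ?thesis
            using iso_mono[of p p d "Suc (i + q) - d" "i + q - d"] by (auto simp: diff_le_mono)
        qed
        moreover have "1 \<le> i + q - k" "(m - (i + q - k + k)) + (m - (i + q - k)) < (m - (i + q)) + (m - i)"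
          using i \<open>k < q\<close> less by arith+
        ultimately show "?Q (\<rho>'(vL := k, vI := i + q - k, vQ := k), \<mu>)"
          using reg reg' i less nb bd \<open>k < q\<close> by (simp add: border_inv_def)
      qed (use reg' i less m_le_n \<open>k < q\<close> in \<open>auto simp: k_def\<close>)
      with False show ?thesis
        using ok n_pos word_size by simp
    qed
  qed (use i less m_le_n in auto)
  then show "pre w border_body ?Q (\<rho>, \<mu>)"
    by (simp add: border_body_def)
next
  fix \<rho> \<mu> assume "border_inv \<rho> \<mu>" "\<not> eval (Plus (Var vI) (Var vQ)) (\<rho>, \<mu>) < eval (Var vM) (\<rho>, \<mu>)"
  moreover from this have "\<rho> vI + \<rho> vQ = m"
    using input_regs[of \<rho> \<mu>] by (simp add: border_inv_def)
  ultimately show "input \<rho> \<mu> \<and> neighbours 0 \<mu> \<and> borders m \<mu>"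
    by (simp add: border_inv_def)
qed

section \<open>Search in the text\<close>

definition found :: "nat \<Rightarrow> (nat \<Rightarrow> nat) \<Rightarrow> bool" where
  "found i \<mu> \<longleftrightarrow> \<mu> 0 \<le> i \<and> distinct (map \<mu> [1..<Suc (\<mu> 0)]) \<and>
     set (map \<mu> [1..<Suc (\<mu> 0)]) = Suc ` {d. d < i \<and> d + m \<le> n \<and> isomorphic_at p t d m}"

lemma found_mono:
  assumes "found i \<mu>" "i \<le> i'" "\<And>d. i \<le> d \<Longrightarrow> d < i' \<Longrightarrow> \<not> isomorphic_at p t d m"
  shows "found i' \<mu>"
proof -
  have "{d. d < i' \<and> d + m \<le> n \<and> isomorphic_at p t d m} = {d. d < i \<and> d + m \<le> n \<and> isomorphic_at p t d m}"
    using assms(2,3) by (auto simp: not_less[symmetric])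
  with assms(1,2) show ?thesis
    by (simp add: found_def)
qed

lemma found_report:
  assumes "found i \<mu>" "isomorphic_at p t i m" "i + m \<le> n"
  shows "found (Suc i) (\<mu>(0 := Suc (\<mu> 0), Suc (\<mu> 0) := Suc i))"
proof -
  let ?\<mu> = "\<mu>(0 := Suc (\<mu> 0), Suc (\<mu> 0) := Suc i)"
  let ?S = "\<lambda>i. {d. d < i \<and> d + m \<le> n \<and> isomorphic_at p t d m}"
  have "map ?\<mu> [1..<Suc (\<mu> 0)] = map \<mu> [1..<Suc (\<mu> 0)]"
    by (rule map_cong) auto
  then have eq: "map ?\<mu> [1..<Suc (?\<mu> 0)] = map \<mu> [1..<Suc (\<mu> 0)] @ [Suc i]"
    by simp
  have S: "?S (Suc i) = insert i (?S i)"
    using assms(2,3) by (auto simp: less_Suc_eq)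
  show ?thesis
    using assms(1) unfolding found_def eq S by auto
qed

text \<open>In place of \<open>input\<close> only the text from \<open>vI\<close> on is kept, since
  the output may destroy the rest. \<open>vQ\<close> stays below \<open>m\<close> because a full
  match is reported and shifted within the same round.\<close>

definition search_inv :: "(nat \<Rightarrow> nat) \<Rightarrow> (nat \<Rightarrow> nat) \<Rightarrow> bool" where
  "search_inv \<rho> \<mu> \<longleftrightarrow> \<rho> vM = m \<and> \<rho> vN = n \<and> \<rho> vB = m + 2 \<and> neighbours 0 \<mu> \<and> borders m \<mu> \<and>
     (\<forall>j. \<rho> vI \<le> j \<and> j < n \<longrightarrow> \<mu> (m + 2 + j) = t j) \<and>
     \<rho> vQ < m \<and> \<rho> vI + \<rho> vQ \<le> n \<and> isomorphic_at p t (\<rho> vI) (\<rho> vQ) \<and> found (\<rho> vI) \<mu>"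

lemma borders_cong:
  assumes "borders k \<mu>" "\<And>a. 24 * n \<le> a \<Longrightarrow> \<mu>' a = \<mu> a"
  shows "borders k \<mu>'"
  using assms by (simp add: borders_def)

lemma wp_search:
  assumes "input \<rho> \<mu>" "neighbours 0 \<mu>" "borders m \<mu>"
  shows "wp w (search_start ;; While_Less (Plus (Var vI) (Var vQ)) (Var vN) search_body)
    (loop_cost search_start (Plus (Var vI) (Var vQ)) (Var vN) search_body (n + n))
    (\<lambda>(\<rho>, \<mu>). distinct (map \<mu> [1..<Suc (\<mu> 0)]) \<and>
      set (map \<mu> [1..<Suc (\<mu> 0)]) = Suc ` {d. d + m \<le> n \<and> isomorphic_at p t d m}) (\<rho>, \<mu>)"
proof (rule wp_loop[where I = search_inv and V = "\<lambda>\<rho>. (n - (\<rho> vI + \<rho> vQ)) + (n - \<rho> vI)"])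
  let ?\<mu> = "\<mu>(0 := 0)"
  have "neighbours 0 ?\<mu>"
    using assms(2) by (rule neighbours_cong) (use n_pos in auto)
  moreover have "borders m ?\<mu>"
    using assms(3) by (rule borders_cong) (use n_pos in auto)
  moreover have "\<forall>j<n. ?\<mu> (m + 2 + j) = t j"
    using assms(1) by (simp add: input_def)
  ultimately have "search_inv (\<rho>(vB := m + 2, vI := 0, vQ := 0)) ?\<mu>"
    using input_regs[OF assms(1)] m_pos by (simp add: search_inv_def found_def)
  then show "pre w search_start (\<lambda>(\<rho>, \<mu>). search_inv \<rho> \<mu> \<and>
      (n - (\<rho> vI + \<rho> vQ)) + (n - \<rho> vI) \<le> n + n) (\<rho>, \<mu>)"
    using input_regs[OF assms(1)] n_pos m_le_n word_size by (simp add: search_start_def)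
next
  fix \<rho> \<mu> assume inv: "search_inv \<rho> \<mu>"
  define i q where "i = \<rho> vI" and "q = \<rho> vQ"
  have reg: "\<rho> vM = m" "\<rho> vN = n" "\<rho> vI = i" "\<rho> vQ = q" and B: "\<rho> vB = m + 2"
    and nb: "neighbours 0 \<mu>" and bd: "borders m \<mu>"
    and window: "\<And>j. i \<le> j \<Longrightarrow> j < n \<Longrightarrow> \<mu> (m + 2 + j) = t j"
    and q: "q < m" and i: "i + q \<le> n" and iso: "isomorphic_at p t i q" and fd: "found i \<mu>"
    using inv by (simp_all add: search_inv_def i_def q_def)
  show "safe w (Plus (Var vI) (Var vQ)) (\<rho>, \<mu>) \<and> safe w (Var vN) (\<rho>, \<mu>)"
    using i n_pos m_le_n word_size by (simp add: reg)
  assume "eval (Plus (Var vI) (Var vQ)) (\<rho>, \<mu>) < eval (Var vN) (\<rho>, \<mu>)"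
  then have less: "i + q < n"
    by (simp add: reg)
  let ?V = "\<lambda>\<rho>. (n - (\<rho> vI + \<rho> vQ)) + (n - \<rho> vI)"
  let ?Q = "\<lambda>(\<rho>', \<mu>'). search_inv \<rho>' \<mu>' \<and> ?V \<rho>' < ?V \<rho>"
  \<comment> \<open>One argument for both uses of \<open>shift\<close>: after a mismatch
    \<open>q' = q\<close>, after a full match \<open>q' = m\<close>.\<close>
  have shifted: "?Q (\<rho>'(vL := k, vI := i + q' - k, vQ := k), \<mu>')"
    if "\<rho>' vM = m" "\<rho>' vN = n" "\<rho>' vB = m + 2" and nb': "neighbours 0 \<mu>'" and bd': "borders m \<mu>'"
      and window': "\<And>j. i < j \<Longrightarrow> j < n \<Longrightarrow> \<mu>' (m + 2 + j) = t j"
      and fd': "found (Suc i) \<mu>'" and q': "q \<le> q'" "q' \<le> m" "i + q' \<le> n"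
      and iso': "isomorphic_at p t i q'" and k: "border p q' k" for \<rho>' \<mu>' q' k
  proof -
    have "k < q'"
      using k by (simp add: border_def)
    have "found (i + q' - k) \<mu>'"
      using fd'
    proof (rule found_mono)
      fix d assume d: "Suc i \<le> d" "d < i + q' - k"
      then have "\<not> isomorphic_at p t d (i + q' - d)"
        by (intro not_iso_between[OF iso' k]) auto
      \<comment> \<open>A match of length \<open>m\<close> at \<open>d\<close> would contain the
        window from \<open>d\<close> to the end of the current one, which has just been
        excluded.\<close>
      moreover have "i + q' - d \<le> m"
        using d q' by linarith
      ultimately show "\<not> isomorphic_at p t d m"
        using iso_mono by blast
    qed (use \<open>k < q'\<close> in auto)
    moreover have "isomorphic_at p t (i + q' - k) k"
      using iso' k by (rule iso_shift)
    moreover have "(n - (i + q' - k + k)) + (n - (i + q' - k)) < (n - (i + q)) + (n - i)"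
      using q' \<open>k < q'\<close> less by arith
    moreover have "\<mu>' (m + 2 + j) = t j" if "i + q' - k \<le> j" "j < n" for j
      using that \<open>k < q'\<close> by (intro window') auto
    ultimately show ?thesis
      using that(1-3) nb' bd' q' \<open>k < q'\<close> by (simp add: search_inv_def reg)
  qed
  let ?report = "Write (Num 0) (Plus (At (Num 0)) (Num 1)) ;; Write (At (Num 0)) (Plus (Var vI) (Num 1)) ;; shift"
  let ?branch = "If_Less (Num 0) (Var vOK)
     (vQ ::= Plus (Var vQ) (Num 1) ;; If_Less (Var vQ) (Var vM) Skip ?report) shift"
  have "pre w check (pre w ?branch ?Q) (\<rho>, \<mu>)"
  proof (rule pre_check[where s = t, OF reg(2-4) B q _ nb _ _ iso])
    show "inj_on t {i..i + q}"
      using inj_t by (rule inj_on_subset) (use less in auto)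
    show "\<mu> (m + 2 + j) = t j" if "i \<le> j" "j \<le> i + q" for j
      using window that less by simp
  next
    fix \<rho>' assume same: "\<And>x. x \<notin> {vX, vOK, vL, vR} \<Longrightarrow> \<rho>' x = \<rho> x"
      and ok: "\<rho>' vOK = (if isomorphic_at p t i (Suc q) then 1 else 0)"
    have reg': "\<rho>' vM = m" "\<rho>' vN = n" "\<rho>' vI = i" "\<rho>' vQ = q" "\<rho>' vB = m + 2"
      using same reg B by auto
    show "pre w ?branch ?Q (\<rho>', \<mu>)"
    proof (cases "isomorphic_at p t i (Suc q)")
      case True
      have "pre w (If_Less (Var vQ) (Var vM) Skip ?report) ?Q (\<rho>'(vQ := Suc q), \<mu>)"
      proof (cases "Suc q < m")
        case True
        have "search_inv (\<rho>'(vQ := Suc q)) \<mu>"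
          using True \<open>isomorphic_at p t i (Suc q)\<close> reg' nb bd window less fd by (simp add: search_inv_def)
        with True show ?thesis
          using reg reg' less by simp
      next
        case False
        then have m: "Suc q = m"
          using q by simp
        define k where "k = \<mu> (24 * n + m)"
        have k: "border p m k"
          using bd m_pos by (simp add: borders_def k_def)
        let ?\<mu> = "\<mu>(0 := Suc (\<mu> 0), Suc (\<mu> 0) := Suc i)"
        \<comment> \<open>With at most \<open>i\<close> earlier reports, the new one goes to a cell
          not above \<open>i + 1\<close>. This is below the text still to be read, which starts at
          \<open>m + 2 + (i + 1)\<close>, and below the tables still in use.\<close>
        have c: "\<mu> 0 \<le> i"
          using fd by (simp add: found_def)
        have "pre w shift ?Q (\<rho>'(vQ := m), ?\<mu>)"
        proof (rule pre_shift[where i = i and q = m and k = k])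
          show "?Q ((\<rho>'(vQ := m))(vL := k, vI := i + m - k, vQ := k), ?\<mu>)"
          proof (rule shifted[where q' = m])
            show "neighbours 0 ?\<mu>"
              using nb by (rule neighbours_cong) (use c less n_pos in auto)
            show "borders m ?\<mu>"
              using bd by (rule borders_cong) (use c less n_pos in auto)
            show "?\<mu> (m + 2 + j) = t j" if "i < j" "j < n" for j
              using window that c by simp
            show "found (Suc i) ?\<mu>"
              using fd True less m by (intro found_report) auto
            show "isomorphic_at p t i m"
              using True m by simp
          qed (use reg' less m k in auto)
          show "?\<mu> (24 * n + m) = k"
            using c less n_pos m_le_n by (simp add: k_def)
          show "k \<le> m"
            using k by (simp add: border_def)
        qed (use reg' less in auto)
        with m c less reg' show ?thesis
          using n_pos word_size by simp
      qed
      with True show ?thesis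
        using ok reg' q n_pos m_le_n word_size by simp
    next
      case False
      then have "0 < q"
        using iso_1 by (cases q) auto
      define k where "k = \<mu> (24 * n + q)"
      have k: "border p q k"
        using bd \<open>0 < q\<close> q by (simp add: borders_def k_def)
      have "\<not> isomorphic_at p t i m"
        using False iso_mono[of p t i m "Suc q"] q by auto
      then have "found (Suc i) \<mu>"
        using fd by (elim found_mono) (auto simp: le_less_Suc_eq)
      have "pre w shift ?Q (\<rho>', \<mu>)"
      proof (rule pre_shift[where i = i and q = q and k = k])
        show "?Q (\<rho>'(vL := k, vI := i + q - k, vQ := k), \<mu>)"
          by (rule shifted[where q' = q]) (use reg' nb bd window \<open>found (Suc i) \<mu>\<close> q i iso k in auto)
        show "k \<le> q"
          using k by (simp add: border_def)
      qed (use reg' q less in \<open>auto simp: k_def\<close>)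
      with False show ?thesis
        using ok n_pos word_size by simp
    qed
  qed (use q less m_le_n in auto)
  then show "pre w search_body ?Q (\<rho>, \<mu>)"
    by (simp add: search_body_def)
next
  fix \<rho> \<mu> assume inv: "search_inv \<rho> \<mu>" "\<not> eval (Plus (Var vI) (Var vQ)) (\<rho>, \<mu>) < eval (Var vN) (\<rho>, \<mu>)"
  \<comment> \<open>At exit \<open>vI + vQ = n\<close> and \<open>vQ < m\<close>, so the pattern no
    longer fits at \<open>vI\<close> or later.\<close>
  then have "n < \<rho> vI + m"
    by (simp add: search_inv_def)
  then have "{d. d < \<rho> vI \<and> d + m \<le> n \<and> isomorphic_at p t d m} = {d. d + m \<le> n \<and> isomorphic_at p t d m}"
    by auto
  with inv(1) show "distinct (map \<mu> [1..<Suc (\<mu> 0)]) \<and>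
      set (map \<mu> [1..<Suc (\<mu> 0)]) = Suc ` {d. d + m \<le> n \<and> isomorphic_at p t d m}"
    by (simp add: search_inv_def found_def)
qed

end

section \<open>The whole program and its running time\<close>

definition matcher :: com where
  "matcher =
     (init_start ;; While_Less (Var vI) (Plus (Var vN) (Num 2)) init_body) ;;
     (vI ::= Num 0 ;; While_Less (Var vI) (Var vM) pos_body) ;;
     (vI ::= Num 1 ;; While_Less (Var vI) (Plus (Var vN) (Num 1)) absent_body) ;;
     (vI ::= Var vM ;; While_Less (Num 0) (Var vI) neighbour_body) ;;
     (border_start ;; While_Less (Plus (Var vI) (Var vQ)) (Var vM) border_body) ;;
     (search_start ;; While_Less (Plus (Var vI) (Var vQ)) (Var vN) search_body)"

text \<open>300 is a generous bound for the initialisation and for one round of each phase. Together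
  the phases then cost at most \<open>300 * (4 * n + 4 * m + 14) \<le> 6600 * n\<close>, which is
  rounded up to \<open>10000 * n\<close>.\<close>

lemma loop_cost_le:
  assumes "cost C0 \<le> 300" "len_expr a + len_expr b + cost C + 2 \<le> 300"
  shows "loop_cost C0 a b C k \<le> 300 * (k + 2)"
proof -
  have "loop_cost C0 a b C k \<le> 300 + (k + 1) * 300"
    unfolding loop_cost_def by (intro add_mono mult_le_mono2 assms)
  then show ?thesis by simp
qed

lemma (in matching) wp_matcher:
  assumes "\<mu> 0 = m" "\<mu> 1 = n" "\<forall>j<m. \<mu> (j + 2) = p j" "\<forall>j<n. \<mu> (m + 2 + j) = t j"
  shows "wp w matcher (10000 * n) (\<lambda>(\<rho>, \<mu>). distinct (map \<mu> [1..<Suc (\<mu> 0)]) \<and>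
      set (map \<mu> [1..<Suc (\<mu> 0)]) = Suc ` {d. d + m \<le> n \<and> isomorphic_at p t d m}) (\<rho>, \<mu>)"
proof -
  have "wp w matcher
     (loop_cost init_start (Var vI) (Plus (Var vN) (Num 2)) init_body (n + 2) +
      (loop_cost (vI ::= Num 0) (Var vI) (Var vM) pos_body m +
      (loop_cost (vI ::= Num 1) (Var vI) (Plus (Var vN) (Num 1)) absent_body n +
      (loop_cost (vI ::= Var vM) (Num 0) (Var vI) neighbour_body m +
      (loop_cost border_start (Plus (Var vI) (Var vQ)) (Var vM) border_body (m + m) +
       loop_cost search_start (Plus (Var vI) (Var vQ)) (Var vN) search_body (n + n))))))
     (\<lambda>(\<rho>, \<mu>). distinct (map \<mu> [1..<Suc (\<mu> 0)]) \<and>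
      set (map \<mu> [1..<Suc (\<mu> 0)]) = Suc ` {d. d + m \<le> n \<and> isomorphic_at p t d m}) (\<rho>, \<mu>)"
    unfolding matcher_def
    by (rule wp_seq[OF wp_init[OF assms]], clarify,
        rule wp_seq[OF wp_pos], assumption+, clarify,
        rule wp_seq[OF wp_absent], assumption+, clarify,
        rule wp_seq[OF wp_neighbour], assumption+, clarify,
        rule wp_seq[OF wp_border], assumption+, clarify,
        rule wp_search, assumption+)
  then show ?thesis
  proof (rule wp_mono)
    show "loop_cost init_start (Var vI) (Plus (Var vN) (Num 2)) init_body (n + 2) +
      (loop_cost (vI ::= Num 0) (Var vI) (Var vM) pos_body m +
      (loop_cost (vI ::= Num 1) (Var vI) (Plus (Var vN) (Num 1)) absent_body n +
      (loop_cost (vI ::= Var vM) (Num 0) (Var vI) neighbour_body m +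
      (loop_cost border_start (Plus (Var vI) (Var vQ)) (Var vM) border_body (m + m) +
       loop_cost search_start (Plus (Var vI) (Var vQ)) (Var vN) search_body (n + n))))) \<le> 10000 * n"
      (is "?T1 + (?T2 + (?T3 + (?T4 + (?T5 + ?T6)))) \<le> _")
    proof -
      have "?T1 \<le> 300 * (n + 4)"
        by (rule order_trans[OF loop_cost_le]) (simp_all add: init_start_def init_body_def)
      moreover have "?T2 \<le> 300 * (m + 2)"
        by (rule loop_cost_le) (simp_all add: pos_body_def)
      moreover have "?T3 \<le> 300 * (n + 2)"
        by (rule loop_cost_le) (simp_all add: absent_body_def unlink_def)
      moreover have "?T4 \<le> 300 * (m + 2)"
        by (rule loop_cost_le) (simp_all add: neighbour_body_def unlink_def)
      moreover have "?T5 \<le> 300 * (m + m + 2)"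
        by (rule loop_cost_le) (simp_all add: border_start_def border_body_def check_def shift_def)
      moreover have "?T6 \<le> 300 * (n + n + 2)"
        by (rule loop_cost_le) (simp_all add: search_start_def search_body_def check_def shift_def)
      moreover have "a + (b + (c + (d + (e + f)))) \<le> 10000 * n"
        if "a \<le> 300 * (n + 4)" "b \<le> 300 * (m + 2)" "c \<le> 300 * (n + 2)" "d \<le> 300 * (m + 2)"
          "e \<le> 300 * (m + m + 2)" "f \<le> 300 * (n + n + 2)" for a b c d e f
        using that n_pos m_le_n by simp
      ultimately show ?thesis
        by blast
    qed
  qed
qed

lemma occurs_at_iff:
  "occurs_at p t i \<longleftrightarrow>
    (\<exists>d. i = Suc d \<and> d + length p \<le> length t \<and> isomorphic_at ((!) p) ((!) t) d (length p))"
proof (cases i)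
  case (Suc d)
  have "order_isomorphic p (take (length p) (drop d t)) \<longleftrightarrow> isomorphic_at ((!) p) ((!) t) d (length p)"
    if "d + length p \<le> length t"
  proof -
    let ?u = "take (length p) (drop d t)"
    have "length ?u = length p"
      using that by simp
    moreover have "(p ! b < p ! a \<longleftrightarrow> ?u ! b < ?u ! a) \<longleftrightarrow> (t ! (d + b) < t ! (d + a) \<longleftrightarrow> p ! b < p ! a)"
      if "a < b" "b < length p" for a b
      using that \<open>d + length p \<le> length t\<close> by auto
    ultimately show ?thesis
      unfolding order_isomorphic_def isomorphic_at_def by metis
  qed
  with Suc show ?thesis
    by (auto simp: occurs_at_def)
qed (simp add: occurs_at_def)

text \<open>This lets the linear bound be absorbed by the claimed one. From \<open>m = 2\<close> on
  the inner logarithm is at least 1; for \<open>m = 1\<close> it is 0, and HOL sets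
  \<open>log 2 0 = 0\<close>; for \<open>m = 0\<close> the factor \<open>m\<close> vanishes.\<close>

lemma log_log_nonneg: "0 \<le> real m * log 2 (log 2 (real m))"
proof (cases "m < 2")
  case True
  then have "m = 0 \<or> m = 1" by auto
  then show ?thesis by (auto simp: log_def)
next
  case False
  then have "1 \<le> log 2 (real m)" by simp
  then show ?thesis by simp
qed

lemma matcher_correct:
  fixes p t :: "nat list"
  assumes "40 * n \<le> 2 ^ w" "p \<noteq> []" "length p = m" "distinct p" "set p \<subseteq> {1..n}"
    "t \<in> permutations_of_set {1..n}"
  shows "runs_within w (compile 0 matcher) ([m, n] @ p @ t)
      (10000 * (real m * log 2 (log 2 (real m)) + real n))
      (\<lambda>ys. distinct ys \<and> set ys = {i. occurs_at p t i})"
  unfolding runs_within_def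
proof (intro allI impI)
  fix c assume init: "initial_config w ([m, n] @ p @ t) c"
  have t: "set t = {1..n}" "distinct t" "length t = n"
    using assms(6) length_finite_permutations_of_set[OF assms(6)] by (auto simp: permutations_of_set_def)
  have "m = card (set p)"
    using assms(3,4) by (simp add: distinct_card)
  also have "\<dots> \<le> n"
    using card_mono[OF _ assms(5)] by simp
  finally have "m \<le> n" .
  interpret matching w n m "(!) p" "(!) t"
  proof
    show "(!) p ` {..<m} \<subseteq> {1..n}"
      using assms(3,5) nth_mem by fastforce
    show "inj_on ((!) p) {..<m}" "inj_on ((!) t) {..<n}"
      using assms(3,4) t by (auto intro!: inj_on_nth)
  qed (use assms \<open>m \<le> n\<close> in auto)
  have mem: "mem c j = ([m, n] @ p @ t) ! j" if "j < m + n + 2" for j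
    using init that assms(3) t(3) by (simp add: initial_config_def)
  have "wp w matcher (10000 * n) (\<lambda>(\<rho>, \<mu>). distinct (map \<mu> [1..<Suc (\<mu> 0)]) \<and>
      set (map \<mu> [1..<Suc (\<mu> 0)]) = Suc ` {d. d + m \<le> n \<and> isomorphic_at ((!) p) ((!) t) d m}) (state_of c)"
    unfolding state_of_def
    by (rule wp_matcher) (use assms(3) t(3) in \<open>auto simp: mem nth_append\<close>)
  then have "reach w (compile 0 matcher) c (10000 * n) (\<lambda>c'. pc c' = 0 + len matcher \<and> words w c' \<and>
      (case state_of c' of (\<rho>, \<mu>) \<Rightarrow> distinct (map \<mu> [1..<Suc (\<mu> 0)]) \<and>
      set (map \<mu> [1..<Suc (\<mu> 0)]) = Suc ` {d. d + m \<le> n \<and> isomorphic_at ((!) p) ((!) t) d m}))"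
    by (rule wpD) (use init in \<open>auto simp: code_at_def initial_config_def words_def\<close>)
  then obtain k where k: "k \<le> 10000 * n" "pc ((step w (compile 0 matcher) ^^ k) c) = len matcher"
    "distinct (output_of ((step w (compile 0 matcher) ^^ k) c))"
    "set (output_of ((step w (compile 0 matcher) ^^ k) c)) =
       Suc ` {d. d + m \<le> n \<and> isomorphic_at ((!) p) ((!) t) d m}"
    unfolding reach_def output_of_def state_of_def prod.case add_0 by blast
  have "{i. occurs_at p t i} = Suc ` {d. d + m \<le> n \<and> isomorphic_at ((!) p) ((!) t) d m}"
    using assms(3) t(3) by (auto simp: occurs_at_iff)
  moreover have "real k \<le> 10000 * (real m * log 2 (log 2 (real m)) + real n)"
  proof -
    have "real k \<le> 10000 * real n"
      using k(1) by simp
    also have "\<dots> \<le> 10000 * (real m * log 2 (log 2 (real m)) + real n)"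
      using log_log_nonneg[of m] by simp
    finally show ?thesis .
  qed
  ultimately show "\<exists>k. real k \<le> 10000 * (real m * log 2 (log 2 (real m)) + real n) \<and>
      halted (compile 0 matcher) ((step w (compile 0 matcher) ^^ k) c) \<and>
      distinct (output_of ((step w (compile 0 matcher) ^^ k) c)) \<and>
      set (output_of ((step w (compile 0 matcher) ^^ k) c)) = {i. occurs_at p t i}"
    using k by (intro exI[of _ k]) (simp add: halted_def)
qed

theorem theorem1:
  "\<exists>(P :: program) (K :: nat) (C :: real). \<forall>(w :: nat) (n :: nat) (m :: nat) (p :: nat list) (t :: nat list).
     K * n \<le> 2 ^ w \<longrightarrow>
     p \<noteq> [] \<longrightarrow> length p = m \<longrightarrow> distinct p \<longrightarrow> set p \<subseteq> {1..n} \<longrightarrow>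
     t \<in> permutations_of_set {1..n} \<longrightarrow>
     runs_within w P ([m, n] @ p @ t) (C * (real m * log 2 (log 2 (real m)) + real n))
       (\<lambda>ys. distinct ys \<and> set ys = {i. occurs_at p t i})"
  using matcher_correct by blast

end
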